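(* (A) Let $\mathcal{M}$ be a factor of type ${\rm II}_\infty$ with a faithful normal semifinite trace $\tau$. Let $\alpha:[0,\infty)\to[0,\infty)$ be a monotone increasing continuous function with $\alpha(0)=0$ and $\alpha(t)>0$ for any $t>0$. Let $\psi_\alpha:\mathcal{M}^+\to[0,\infty]$ be the non-linear trace of the Sugeno type associated with $\alpha$, and define $\|a\|_\alpha:=\psi_\alpha(|a|)$ for $a\in\mathcal{M}$. Assume that $\alpha$ is concave. Then $\|\cdot\|_\alpha$ satisfies the triangle inequality: for any $b,c\in\mathcal{M}$, $$\|b+c\|_\alpha\le\|b\|_\alpha+\|c\|_\alpha.$$ (B) The same holds if $\mathcal{M}$ is a factor of type ${\rm II}_1$ with a faithful normal finite trace $\tau$, $\tau(I)=1$, and $\alpha:[0,1]\to[0,\infty)$ is a monotone increasing continuous concave function with $\alpha(0)=0$ and $\alpha(t)>0$ for any $t>0$.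
   Context: "Monotone increasing" means non-decreasing; $\land$ denotes minimum. For $a\in\mathcal{M}^+$, $e_{(s,\infty)}(a)$ denotes the spectral projection of $a$ for $(s,\infty)$. With the convention $\alpha(\infty)=\lim_{t\to\infty}\alpha(t)$ in the type ${\rm II}_\infty$ case, the non-linear trace of the Sugeno type associated with $\alpha$ is $$\psi_\alpha(a)=\sup_{s\in[0,\infty)}s\land\alpha(\tau(e_{(s,\infty)}(a)))\qquad(a\in\mathcal{M}^+).$$ $|a|=(a^*a)^{1/2}$. *)

theory Defs
  imports "HOL-Analysis.Analysis"
begin

(* Complex Hilbert spaces.  cinner is linear in the first argument.  Definiteness of cinner and
   the norm come from real_inner through inner_eq_Re_cinner: cinner x x is real by
   cinner_commute, so it equals inner x x = (norm x)^2. *)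
class chilbert_space = real_inner + complete_space +
  fixes scaleC :: "complex \<Rightarrow> 'a \<Rightarrow> 'a" (infixr "*\<^sub>C" 75)
    and cinner :: "'a \<Rightarrow> 'a \<Rightarrow> complex"
  assumes scaleC_add_right: "c *\<^sub>C (x + y) = c *\<^sub>C x + c *\<^sub>C y"
    and scaleC_add_left: "(c + d) *\<^sub>C x = c *\<^sub>C x + d *\<^sub>C x"
    and scaleC_scaleC: "c *\<^sub>C d *\<^sub>C x = (c * d) *\<^sub>C x"
    and scaleR_scaleC: "r *\<^sub>R x = complex_of_real r *\<^sub>C x"
    and cinner_commute: "cinner x y = cnj (cinner y x)"
    and cinner_add_left: "cinner (x + y) z = cinner x z + cinner y z"
    and cinner_scaleC_left: "cinner (c *\<^sub>C x) y = c * cinner x y"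
    and inner_eq_Re_cinner: "inner x y = Re (cinner x y)"

(* B(H).  The type of bounded real-linear maps is larger, so every notion below that ranges
   over operators restricts to this set. *)
definition bounded_ops :: "('h::chilbert_space \<Rightarrow>\<^sub>L 'h) set" where
  "bounded_ops = {a. \<forall>c x. blinfun_apply a (c *\<^sub>C x) = c *\<^sub>C blinfun_apply a x}"

definition adj :: "('h::chilbert_space \<Rightarrow>\<^sub>L 'h) \<Rightarrow> ('h \<Rightarrow>\<^sub>L 'h)" where
  "adj a = (THE b. \<forall>x y. cinner (blinfun_apply a x) y = cinner x (blinfun_apply b y))"

definition positive_op :: "('h::chilbert_space \<Rightarrow>\<^sub>L 'h) \<Rightarrow> bool" where
  "positive_op a \<longleftrightarrow> a \<in> bounded_ops \<and> (\<forall>x. cinner (blinfun_apply a x) x \<in> \<real>\<^sub>\<ge>\<^sub>0)"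

definition op_le :: "('h::chilbert_space \<Rightarrow>\<^sub>L 'h) \<Rightarrow> ('h \<Rightarrow>\<^sub>L 'h) \<Rightarrow> bool" (infix "\<sqsubseteq>" 50) where
  "a \<sqsubseteq> b \<longleftrightarrow> positive_op (b - a)"

definition projection :: "('h::chilbert_space \<Rightarrow>\<^sub>L 'h) \<Rightarrow> bool" where
  "projection p \<longleftrightarrow> p \<in> bounded_ops \<and> p o\<^sub>L p = p \<and> adj p = p"

definition op_sqrt :: "('h::chilbert_space \<Rightarrow>\<^sub>L 'h) \<Rightarrow> ('h \<Rightarrow>\<^sub>L 'h)" where
  "op_sqrt a = (THE b. positive_op b \<and> b o\<^sub>L b = a)"

definition op_abs :: "('h::chilbert_space \<Rightarrow>\<^sub>L 'h) \<Rightarrow> ('h \<Rightarrow>\<^sub>L 'h)" where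
  "op_abs a = op_sqrt (adj a o\<^sub>L a)"


definition projection_valued_measure :: "(real set \<Rightarrow> ('h::chilbert_space \<Rightarrow>\<^sub>L 'h)) \<Rightarrow> bool" where
  "projection_valued_measure E \<longleftrightarrow>
     (\<forall>B\<in>sets borel. projection (E B)) \<and>
     E UNIV = id_blinfun \<and>
     (\<forall>A\<in>sets borel. \<forall>B\<in>sets borel. E (A \<inter> B) = E A o\<^sub>L E B) \<and>
     (\<forall>A :: nat \<Rightarrow> real set. range A \<subseteq> sets borel \<and> disjoint_family A \<longrightarrow>
        (\<forall>x. (\<lambda>n. blinfun_apply (E (A n)) x) sums blinfun_apply (E (\<Union>n. A n)) x))"

(* the scalar measure B \<mapsto> <E(B) x, x> *)
definition scalar_spectral_measure ::
    "(real set \<Rightarrow> ('h::chilbert_space \<Rightarrow>\<^sub>L 'h)) \<Rightarrow> 'h \<Rightarrow> real measure" where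
  "scalar_spectral_measure E x =
     measure_of UNIV (sets borel) (\<lambda>B. ennreal (Re (cinner (blinfun_apply (E B) x) x)))"

(* a = \<integral> t dE(t) in the weak sense; by polarization the diagonal values <a x, x> suffice *)
definition is_spectral_measure ::
    "('h::chilbert_space \<Rightarrow>\<^sub>L 'h) \<Rightarrow> (real set \<Rightarrow> ('h \<Rightarrow>\<^sub>L 'h)) \<Rightarrow> bool" where
  "is_spectral_measure a E \<longleftrightarrow> projection_valued_measure E \<and>
     (\<forall>x. integrable (scalar_spectral_measure E x) (\<lambda>t. t) \<and>
        cinner (blinfun_apply a x) x = complex_of_real (\<integral>t. t \<partial>scalar_spectral_measure E x))"

(* e_B(a) for self-adjoint a and Borel B.  The spectral measure of a exists and is unique on
   Borel sets by the spectral theorem; its values on other sets are irrelevant. *)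
definition spectral_projection :: "('h::chilbert_space \<Rightarrow>\<^sub>L 'h) \<Rightarrow> real set \<Rightarrow> ('h \<Rightarrow>\<^sub>L 'h)" where
  "spectral_projection a = (SOME E. is_spectral_measure a E)"


definition commutant :: "('h::chilbert_space \<Rightarrow>\<^sub>L 'h) set \<Rightarrow> ('h \<Rightarrow>\<^sub>L 'h) set" where
  "commutant S = {a \<in> bounded_ops. \<forall>b\<in>S. a o\<^sub>L b = b o\<^sub>L a}"

(* A self-adjoint set equal to its bicommutant is automatically a unital *-subalgebra. *)
definition von_neumann_algebra :: "('h::chilbert_space \<Rightarrow>\<^sub>L 'h) set \<Rightarrow> bool" where
  "von_neumann_algebra M \<longleftrightarrow>
     M \<subseteq> bounded_ops \<and> (\<forall>a\<in>M. adj a \<in> M) \<and> commutant (commutant M) = M"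

definition factor :: "('h::chilbert_space \<Rightarrow>\<^sub>L 'h) set \<Rightarrow> bool" where
  "factor M \<longleftrightarrow> von_neumann_algebra M \<and>
     (\<forall>z \<in> M \<inter> commutant M. \<exists>c. \<forall>x. blinfun_apply z x = c *\<^sub>C x)"

definition mvn_equiv ::
    "('h::chilbert_space \<Rightarrow>\<^sub>L 'h) set \<Rightarrow> ('h \<Rightarrow>\<^sub>L 'h) \<Rightarrow> ('h \<Rightarrow>\<^sub>L 'h) \<Rightarrow> bool" where
  "mvn_equiv M p q \<longleftrightarrow> (\<exists>v\<in>M. adj v o\<^sub>L v = p \<and> v o\<^sub>L adj v = q)"

definition finite_projection :: "('h::chilbert_space \<Rightarrow>\<^sub>L 'h) set \<Rightarrow> ('h \<Rightarrow>\<^sub>L 'h) \<Rightarrow> bool" where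
  "finite_projection M p \<longleftrightarrow> p \<in> M \<and> projection p \<and>
     (\<forall>q\<in>M. projection q \<and> q \<sqsubseteq> p \<and> mvn_equiv M q p \<longrightarrow> q = p)"

definition abelian_projection :: "('h::chilbert_space \<Rightarrow>\<^sub>L 'h) set \<Rightarrow> ('h \<Rightarrow>\<^sub>L 'h) \<Rightarrow> bool" where
  "abelian_projection M p \<longleftrightarrow> p \<in> M \<and> projection p \<and>
     (\<forall>a\<in>M. \<forall>b\<in>M. (p o\<^sub>L a o\<^sub>L p) o\<^sub>L (p o\<^sub>L b o\<^sub>L p) = (p o\<^sub>L b o\<^sub>L p) o\<^sub>L (p o\<^sub>L a o\<^sub>L p))"

definition type_II_factor :: "('h::chilbert_space \<Rightarrow>\<^sub>L 'h) set \<Rightarrow> bool" where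
  "type_II_factor M \<longleftrightarrow> factor M \<and>
     (\<forall>p. abelian_projection M p \<longrightarrow> p = 0) \<and> (\<exists>p. finite_projection M p \<and> p \<noteq> 0)"

definition type_II_1_factor :: "('h::chilbert_space \<Rightarrow>\<^sub>L 'h) set \<Rightarrow> bool" where
  "type_II_1_factor M \<longleftrightarrow> type_II_factor M \<and> finite_projection M id_blinfun"

definition type_II_infinity_factor :: "('h::chilbert_space \<Rightarrow>\<^sub>L 'h) set \<Rightarrow> bool" where
  "type_II_infinity_factor M \<longleftrightarrow> type_II_factor M \<and> \<not> finite_projection M id_blinfun"


definition positive_part :: "('h::chilbert_space \<Rightarrow>\<^sub>L 'h) set \<Rightarrow> ('h \<Rightarrow>\<^sub>L 'h) set" where
  "positive_part M = {a \<in> M. positive_op a}"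

(* Traces are functions from the positive part of M to [0, \<infinity>]; the convention 0 * \<infinity> = 0
   needed for homogeneity is that of ennreal. *)
definition is_trace ::
    "('h::chilbert_space \<Rightarrow>\<^sub>L 'h) set \<Rightarrow> (('h \<Rightarrow>\<^sub>L 'h) \<Rightarrow> ennreal) \<Rightarrow> bool" where
  "is_trace M \<tau> \<longleftrightarrow>
     (\<forall>a\<in>positive_part M. \<forall>b\<in>positive_part M. \<tau> (a + b) = \<tau> a + \<tau> b) \<and>
     (\<forall>a\<in>positive_part M. \<forall>r\<ge>0. \<tau> (r *\<^sub>R a) = ennreal r * \<tau> a) \<and>
     (\<forall>a\<in>M. \<tau> (adj a o\<^sub>L a) = \<tau> (a o\<^sub>L adj a))"

definition faithful_trace ::
    "('h::chilbert_space \<Rightarrow>\<^sub>L 'h) set \<Rightarrow> (('h \<Rightarrow>\<^sub>L 'h) \<Rightarrow> ennreal) \<Rightarrow> bool" where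
  "faithful_trace M \<tau> \<longleftrightarrow> (\<forall>a\<in>positive_part M. \<tau> a = 0 \<longrightarrow> a = 0)"

(* \<tau> preserves suprema of bounded increasing nets, phrased with upward directed sets *)
definition normal_trace ::
    "('h::chilbert_space \<Rightarrow>\<^sub>L 'h) set \<Rightarrow> (('h \<Rightarrow>\<^sub>L 'h) \<Rightarrow> ennreal) \<Rightarrow> bool" where
  "normal_trace M \<tau> \<longleftrightarrow>
     (\<forall>D a. D \<subseteq> positive_part M \<and> D \<noteq> {} \<and>
        (\<forall>x\<in>D. \<forall>y\<in>D. \<exists>z\<in>D. x \<sqsubseteq> z \<and> y \<sqsubseteq> z) \<and>
        a \<in> positive_part M \<and> (\<forall>x\<in>D. x \<sqsubseteq> a) \<and>
        (\<forall>b\<in>positive_part M. (\<forall>x\<in>D. x \<sqsubseteq> b) \<longrightarrow> a \<sqsubseteq> b)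
        \<longrightarrow> \<tau> a = (SUP x\<in>D. \<tau> x))"

definition semifinite_trace ::
    "('h::chilbert_space \<Rightarrow>\<^sub>L 'h) set \<Rightarrow> (('h \<Rightarrow>\<^sub>L 'h) \<Rightarrow> ennreal) \<Rightarrow> bool" where
  "semifinite_trace M \<tau> \<longleftrightarrow>
     (\<forall>a\<in>positive_part M. a \<noteq> 0 \<longrightarrow> (\<exists>b\<in>positive_part M. b \<noteq> 0 \<and> b \<sqsubseteq> a \<and> \<tau> b < \<infinity>))"

definition finite_trace ::
    "('h::chilbert_space \<Rightarrow>\<^sub>L 'h) set \<Rightarrow> (('h \<Rightarrow>\<^sub>L 'h) \<Rightarrow> ennreal) \<Rightarrow> bool" where
  "finite_trace M \<tau> \<longleftrightarrow> (\<forall>a\<in>positive_part M. \<tau> a < \<infinity>)"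


(* \<alpha> on [0, \<infinity>] with \<alpha>(\<infinity>) = lim \<alpha>(t) as t \<rightarrow> \<infinity>, taken in [0, \<infinity>] since \<alpha> may be unbounded *)
definition extend_infinity :: "(real \<Rightarrow> real) \<Rightarrow> ennreal \<Rightarrow> ennreal" where
  "extend_infinity \<alpha> t =
     (if t = \<infinity> then Lim at_top (\<lambda>r. ennreal (\<alpha> r)) else ennreal (\<alpha> (enn2real t)))"

definition sugeno_trace ::
    "(('h::chilbert_space \<Rightarrow>\<^sub>L 'h) \<Rightarrow> ennreal) \<Rightarrow> (real \<Rightarrow> real) \<Rightarrow> ('h \<Rightarrow>\<^sub>L 'h) \<Rightarrow> ennreal" where
  "sugeno_trace \<tau> \<alpha> a =
     (SUP s\<in>{0..}. min (ennreal s) (extend_infinity \<alpha> (\<tau> (spectral_projection a {s<..}))))"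

definition sugeno_norm ::
    "(('h::chilbert_space \<Rightarrow>\<^sub>L 'h) \<Rightarrow> ennreal) \<Rightarrow> (real \<Rightarrow> real) \<Rightarrow> ('h \<Rightarrow>\<^sub>L 'h) \<Rightarrow> ennreal" where
  "sugeno_norm \<tau> \<alpha> a = sugeno_trace \<tau> \<alpha> (op_abs a)"

end

theory Submission
  imports Defs
begin

text \<open>
  Let \<open>p\<close>, \<open>q\<close>, \<open>r\<close> be the spectral projections of \<open>|b|\<close>, \<open>|c|\<close>, \<open>|b + c|\<close> for \<open>(s, \<infinity>)\<close>,
  \<open>(t, \<infinity>)\<close>, \<open>(s + t, \<infinity>)\<close>. A vector \<open>x\<close> in the range of \<open>r\<close> that is killed by \<open>p\<close> and \<open>q\<close> has
  \<open>\<parallel>(b + c) x\<parallel> \<le> (s + t) \<parallel>x\<parallel>\<close> and hence vanishes, so \<open>r\<close> is equivalent to a subprojection of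
  \<open>p \<squnion> q\<close> and \<open>\<tau> r \<le> \<tau> p + \<tau> q\<close>. A concave \<open>\<alpha>\<close> with \<open>\<alpha> 0 = 0\<close> is subadditive, which turns
  this into the triangle inequality: for \<open>s > \<parallel>b\<parallel>\<^sub>\<alpha>\<close> and \<open>t > \<parallel>c\<parallel>\<^sub>\<alpha>\<close> the definition of the supremum
  gives \<open>\<alpha> (\<tau> p) \<le> \<parallel>b\<parallel>\<^sub>\<alpha>\<close> and \<open>\<alpha> (\<tau> q) \<le> \<parallel>c\<parallel>\<^sub>\<alpha>\<close>.

  The spectral theorem is proved for self-adjoint operators on real Hilbert spaces: the projection
  for \<open>(-\<infinity>, s]\<close> is the kernel projection of \<open>|a - s| + (a - s)\<close>, and a Dynkin argument extends the
  resulting Stieltjes measures to projections on all Borel sets. Complex linearity and membership in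
  the von Neumann algebra come for free, because every construction stays in the bicommutant.
\<close>

section \<open>Bounded operators on a real Hilbert space\<close>

text \<open>The representing vector minimises \<open>(norm x)\<^sup>2 - 2 * f x\<close>. This
  functional is bounded below, the parallelogram law makes a minimising sequence Cauchy, and the
  vanishing first variation at its limit is the representation.\<close>

lemma riesz_representation:
  fixes f :: "'a::{real_inner,banach} \<Rightarrow> real"
  assumes f: "bounded_linear f"
  obtains y where "\<And>x. f x = inner x y"
proof -
  interpret f: bounded_linear f by fact
  define \<phi> where "\<phi> x = (norm x)\<^sup>2 - 2 * f x" for x
  obtain K where K: "\<And>x. norm (f x) \<le> norm x * K"
    using f.bounded by blast
  have lower: "- (K\<^sup>2) \<le> \<phi> x" for x
  proof -
    have "f x \<le> norm x * K" using K[of x] by (simp add: abs_le_iff)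
    moreover have "0 \<le> (norm x - K)\<^sup>2" by simp
    ultimately show ?thesis by (simp add: \<phi>_def power2_eq_square algebra_simps)
  qed
  define m where "m = Inf (range \<phi>)"
  have bdd: "bdd_below (range \<phi>)" using lower by (auto simp: bdd_below_def)
  have m_le: "m \<le> \<phi> x" for x
    unfolding m_def by (rule cInf_lower) (auto simp: bdd)
  have "\<exists>x. \<phi> x < m + 1 / real (Suc n)" for n
    using cInf_lessD[of "range \<phi>" "m + 1 / real (Suc n)"] by (auto simp: m_def)
  then obtain X where X: "\<And>n. \<phi> (X n) < m + 1 / real (Suc n)" by metis
  \<comment> \<open>By the parallelogram law the linear part of \<open>\<phi>\<close> cancels; the
    value of \<open>\<phi>\<close> at the midpoint is at least \<open>m\<close>.\<close>
  have dist_bound: "(norm (x - y))\<^sup>2 \<le> 2 * (\<phi> x - m) + 2 * (\<phi> y - m)" for x y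
  proof -
    have "(norm (x - y))\<^sup>2 = 2 * \<phi> x + 2 * \<phi> y - 4 * \<phi> ((1/2) *\<^sub>R (x + y))"
      by (simp add: \<phi>_def power2_norm_eq_inner inner_add inner_diff f.add f.scaleR inner_commute
          power_mult_distrib algebra_simps)
    then show ?thesis using m_le[of "(1/2) *\<^sub>R (x + y)"] by simp
  qed
  have "Cauchy X"
  proof (rule metric_CauchyI)
    fix e :: real assume "e > 0"
    then obtain N where N: "1 / real (Suc N) < e\<^sup>2 / 4"
      using nat_approx_posE[of "e\<^sup>2 / 4"] by auto
    have eps: "4 * (\<phi> (X i) - m) < e\<^sup>2" if "i \<ge> N" for i
    proof -
      have "\<phi> (X i) < m + 1 / real (Suc i)" by (rule X)
      also have "\<dots> \<le> m + 1 / real (Suc N)"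
        using that by (intro add_left_mono) (simp add: frac_le)
      also have "\<dots> < m + e\<^sup>2 / 4" using N by (rule add_strict_left_mono)
      finally show ?thesis by simp
    qed
    have "dist (X i) (X j) < e" if "i \<ge> N" "j \<ge> N" for i j
    proof -
      have "(norm (X i - X j))\<^sup>2 < e\<^sup>2"
        using dist_bound[of "X i" "X j"] eps[OF that(1)] eps[OF that(2)] by argo
      then show ?thesis
        unfolding dist_norm by (rule power2_less_imp_less) (use \<open>e > 0\<close> in simp)
    qed
    then show "\<exists>N. \<forall>m\<ge>N. \<forall>n\<ge>N. dist (X m) (X n) < e" by blast
  qed
  then obtain y where y: "X \<longlonglongrightarrow> y" using Cauchy_convergent convergent_def by blast
  have "(\<lambda>n. \<phi> (X n)) \<longlonglongrightarrow> \<phi> y"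
    unfolding \<phi>_def by (intro tendsto_intros f.tendsto y)
  moreover have "(\<lambda>n. m + 1 / real (Suc n)) \<longlonglongrightarrow> m + 0"
    by (intro tendsto_intros LIMSEQ_Suc lim_1_over_n)
  ultimately have "\<phi> y \<le> m + 0"
    by (rule LIMSEQ_le) (use X less_imp_le in blast)
  have "f x = inner x y" for x
  proof (cases "x = 0")
    case False
    define d where "d = inner x y - f x"
    \<comment> \<open>This \<open>t\<close> minimises
      \<open>t\<^sup>2 * (norm x)\<^sup>2 + 2 * t * d\<close>, the increment of
      \<open>\<phi>\<close> from \<open>y\<close> to \<open>y + t *\<^sub>R x\<close>.\<close>
    define t where "t = - d / (norm x)\<^sup>2"
    have "\<phi> y \<le> \<phi> (y + t *\<^sub>R x)" using m_le \<open>\<phi> y \<le> m + 0\<close> by (metis add.right_neutral order_trans)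
    then have "0 \<le> t\<^sup>2 * (norm x)\<^sup>2 + 2 * t * d"
      by (simp add: \<phi>_def d_def power2_norm_eq_inner inner_add f.add f.scaleR inner_commute
          power2_eq_square[of t] algebra_simps)
    also have "\<dots> = - (d\<^sup>2 / (norm x)\<^sup>2)"
      using False by (simp add: t_def field_simps power2_eq_square)
    finally have "d = 0" using False by (simp add: divide_le_0_iff)
    then show ?thesis by (simp add: d_def)
  qed (simp add: f.zero)
  then show thesis using that by blast
qed

lemma adjoint_exists:
  fixes a :: "'a::{real_inner,banach} \<Rightarrow>\<^sub>L 'a"
  obtains b :: "'a \<Rightarrow>\<^sub>L 'a" where "\<And>x y. inner (a x) y = inner x (b y)"
proof -
  have "\<exists>z. \<forall>x. inner (a x) y = inner x z" for y
  proof -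
    have "bounded_linear (\<lambda>x. inner (a x) y)"
      by (intro bounded_linear_intros)
    then show ?thesis by (metis riesz_representation)
  qed
  then obtain g where g: "\<And>x y. inner (a x) y = inner x (g y)" by metis
  have "bounded_linear g"
  proof (rule bounded_linear_intro[where K = "norm a"])
    show "g (x + y) = g x + g y" for x y
      by (rule vector_eq_ldot[THEN iffD1]) (simp add: g[symmetric] inner_add)
    show "g (r *\<^sub>R x) = r *\<^sub>R g x" for r x
      by (rule vector_eq_ldot[THEN iffD1]) (simp add: g[symmetric])
    show "norm (g x) \<le> norm x * norm a" for x
    proof -
      have "norm (g x) * norm (g x) = inner (a (g x)) x"
        by (simp add: g flip: power2_eq_square power2_norm_eq_inner)
      also have "\<dots> \<le> norm (a (g x)) * norm x" by (rule norm_cauchy_schwarz)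
      also have "\<dots> \<le> norm a * norm (g x) * norm x"
        by (intro mult_right_mono norm_blinfun) auto
      finally show ?thesis
        by (cases "norm (g x) = 0") (auto simp: mult.commute mult.left_commute)
    qed
  qed
  then show thesis using that[of "Blinfun g"] g by (simp add: bounded_linear_Blinfun_apply)
qed

text \<open>Serves powers of a contraction and increasing projections, which converge strongly but
  in general not in norm.\<close>

lemma strong_limit_exists:
  fixes q :: "nat \<Rightarrow> 'a::{real_inner,banach} \<Rightarrow>\<^sub>L 'a"
  assumes conv: "\<And>x. convergent (\<lambda>n. q n x)" and bound: "\<And>n x. norm (q n x) \<le> norm x"
  obtains b :: "'a \<Rightarrow>\<^sub>L 'a" where "\<And>x. (\<lambda>n. q n x) \<longlonglongrightarrow> b x"
proof -
  define g where "g x = lim (\<lambda>n. q n x)" for x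
  have g: "(\<lambda>n. q n x) \<longlonglongrightarrow> g x" for x
    using conv by (simp add: g_def convergent_LIMSEQ_iff)
  have "bounded_linear g"
  proof (rule bounded_linear_intro[where K = 1])
    show "g (x + y) = g x + g y" for x y
      using LIMSEQ_unique[OF g[of "x + y"], of "g x + g y"] tendsto_add[OF g[of x] g[of y]]
      by (simp add: blinfun.add_right)
    show "g (r *\<^sub>R x) = r *\<^sub>R g x" for r x
      using LIMSEQ_unique[OF g[of "r *\<^sub>R x"], of "r *\<^sub>R g x"] tendsto_scaleR[OF tendsto_const g[of x]]
      by (simp add: blinfun.scaleR_right)
    show "norm (g x) \<le> norm x * 1" for x
      using LIMSEQ_le_const2[OF tendsto_norm[OF g[of x]]] bound by auto
  qed
  then show thesis using that[of "Blinfun g"] g by (simp add: bounded_linear_Blinfun_apply)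
qed

section \<open>Self-adjoint operators, positive operators, projections and commutation\<close>

definition selfadj :: "('a::real_inner \<Rightarrow>\<^sub>L 'a) \<Rightarrow> bool" where
  "selfadj a \<longleftrightarrow> (\<forall>x y. inner (a x) y = inner x (a y))"

text \<open>Self-adjointness is demanded explicitly: on a real space it does not follow from
  nonnegativity of the quadratic form.\<close>

definition pos :: "('a::real_inner \<Rightarrow>\<^sub>L 'a) \<Rightarrow> bool" where
  "pos a \<longleftrightarrow> selfadj a \<and> (\<forall>x. 0 \<le> inner (a x) x)"

definition proj :: "('a::real_inner \<Rightarrow>\<^sub>L 'a) \<Rightarrow> bool" where
  "proj p \<longleftrightarrow> selfadj p \<and> (\<forall>x. p (p x) = p x)"

definition commute :: "('a::real_normed_vector \<Rightarrow>\<^sub>L 'a) \<Rightarrow> ('a \<Rightarrow>\<^sub>L 'a) \<Rightarrow> bool" where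
  "commute u a \<longleftrightarrow> (\<forall>x. u (a x) = a (u x))"

text \<open>Here \<open>u\<close> ranges over all bounded real-linear operators. Taking for
  \<open>u\<close> the complex scalars shows that \<open>b\<close> inherits complex linearity from
  \<open>a\<close>; taking elements of a commutant shows that it inherits membership in a von
  Neumann algebra.\<close>

definition in_bicommutant :: "('a::real_normed_vector \<Rightarrow>\<^sub>L 'a) \<Rightarrow> ('a \<Rightarrow>\<^sub>L 'a) \<Rightarrow> bool" where
  "in_bicommutant a b \<longleftrightarrow> (\<forall>u. commute u a \<longrightarrow> commute u b)"

lemma selfadjD: "selfadj a \<Longrightarrow> inner (a x) y = inner x (a y)"
  by (simp add: selfadj_def)

lemma selfadj_simps [simp]:
  "selfadj 0" "selfadj id_blinfun"
  "selfadj a \<Longrightarrow> selfadj b \<Longrightarrow> selfadj (a + b)"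
  "selfadj a \<Longrightarrow> selfadj b \<Longrightarrow> selfadj (a - b)"
  "selfadj a \<Longrightarrow> selfadj (- a)"
  "selfadj a \<Longrightarrow> selfadj (r *\<^sub>R a)"
  by (auto simp: selfadj_def blinfun.bilinear_simps inner_add inner_diff)

lemma selfadj_comp: "selfadj a \<Longrightarrow> selfadj b \<Longrightarrow> commute a b \<Longrightarrow> selfadj (a o\<^sub>L b)"
  by (simp add: selfadj_def commute_def)

lemma pos_selfadj: "pos a \<Longrightarrow> selfadj a" and pos_ge_0: "pos a \<Longrightarrow> 0 \<le> inner (a x) x"
  by (auto simp: pos_def)

lemma proj_selfadj: "proj p \<Longrightarrow> selfadj p" and proj_idem: "proj p \<Longrightarrow> p (p x) = p x"
  by (auto simp: proj_def)

lemma proj_inner: "proj p \<Longrightarrow> inner (p x) x = (norm (p x))\<^sup>2"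
  by (metis power2_norm_eq_inner proj_idem proj_selfadj selfadjD)

lemma proj_pos: "proj p \<Longrightarrow> pos p"
  by (simp add: pos_def proj_inner proj_selfadj)

lemma proj_compl: "proj p \<Longrightarrow> proj (id_blinfun - p)"
  by (simp add: proj_def blinfun.bilinear_simps)

lemma proj_norm_le: "proj p \<Longrightarrow> norm (p x) \<le> norm x"
proof -
  assume p: "proj p"
  have "norm (p x) * norm (p x) \<le> norm (p x) * norm x"
    using proj_inner[OF p, of x] norm_cauchy_schwarz[of "p x" x] by (simp add: power2_eq_square)
  then show ?thesis by (cases "norm (p x) = 0") auto
qed

text \<open>Polarisation in one evaluation: at \<open>x + c x\<close> the form reduces to its cross
  terms, which add up to \<open>2 * (norm (c x))\<^sup>2\<close>.\<close>

lemma selfadj_eq_0: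
  assumes "selfadj c" "\<And>x. inner (c x) x = 0"
  shows "c = 0"
proof (rule blinfun_eqI)
  fix x
  have "inner (c (x + c x)) (x + c x) = 0" by (rule assms)
  then have "inner (c x) (c x) + inner (c (c x)) x = 0"
    using assms(2)[of x] assms(2)[of "c x"] by (simp add: blinfun.add_right inner_add)
  moreover have "inner (c (c x)) x = inner (c x) (c x)" using assms(1) by (simp add: selfadjD)
  ultimately show "c x = blinfun_apply 0 x" by simp
qed

lemma selfadj_eqI:
  assumes "selfadj a" "selfadj b" "\<And>x. inner (a x) x = inner (b x) x"
  shows "a = b"
  using selfadj_eq_0[of "a - b"] assms by (simp add: blinfun.diff_left inner_diff_left)

text \<open>The form is nonnegative along the line \<open>x + t *\<^sub>R y\<close>, so the
  discriminant of the quadratic in \<open>t\<close> is at most zero. The form may be degenerate,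
  hence the separate case \<open>C = 0\<close>.\<close>

lemma pos_cauchy_schwarz:
  assumes "pos a"
  shows "(inner (a x) y)\<^sup>2 \<le> inner (a x) x * inner (a y) y"
proof -
  define A B C where "A = inner (a x) x" and "B = inner (a x) y" and "C = inner (a y) y"
  have nonneg: "0 \<le> A" "0 \<le> C" using assms by (auto simp: A_def C_def pos_def)
  have quad: "0 \<le> A + 2 * t * B + t\<^sup>2 * C" for t
  proof -
    have "inner (a y) x = B"
      using selfadjD[OF pos_selfadj[OF assms], of y x] inner_commute[of y "a x"] by (simp add: B_def)
    then have "inner (a (x + t *\<^sub>R y)) (x + t *\<^sub>R y) = A + 2 * t * B + t\<^sup>2 * C"
      by (simp add: blinfun.bilinear_simps inner_add A_def B_def C_def algebra_simps power2_eq_square)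
    then show ?thesis using assms pos_ge_0 by metis
  qed
  have "B\<^sup>2 \<le> A * C"
  proof (cases "C = 0")
    case True
    have "B = 0"
    proof (rule ccontr)
      assume "B \<noteq> 0"
      \<comment> \<open>For \<open>C = 0\<close> the polynomial is affine in \<open>t\<close>; this
        \<open>t\<close> gives it the value \<open>-1\<close>.\<close>
      then show False using quad[of "- (A + 1) / (2 * B)"] True by (simp add: field_simps)
    qed
    then show ?thesis using nonneg True by simp
  next
    case False
    then have "0 \<le> C * (A + 2 * (- B / C) * B + (- B / C)\<^sup>2 * C)"
      using quad nonneg mult_nonneg_nonneg by blast
    also have "\<dots> = A * C - B\<^sup>2" using False by (simp add: field_simps power2_eq_square)
    finally show ?thesis by simp
  qed
  then show ?thesis by (simp add: A_def B_def C_def)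
qed

text \<open>Turns a bound on the form into a bound on the norm: apply
  \<open>pos_cauchy_schwarz\<close> with \<open>y = a x\<close>, estimate both forms by
  \<open>s\<close>, and cancel \<open>(norm (a x))\<^sup>2\<close>.\<close>

lemma pos_bound:
  assumes "pos a" "0 \<le> s" "\<And>x. inner (a x) x \<le> s * (norm x)\<^sup>2"
  shows "norm (a x) \<le> s * norm x"
proof (cases "a x = 0")
  case False
  have "((norm (a x))\<^sup>2)\<^sup>2 \<le> inner (a x) x * inner (a (a x)) (a x)"
    using pos_cauchy_schwarz[OF assms(1), of x "a x"] by (simp add: power2_norm_eq_inner)
  also have "\<dots> \<le> (s * (norm x)\<^sup>2) * (s * (norm (a x))\<^sup>2)"
    using assms by (intro mult_mono) (auto simp: pos_def)
  finally have "(norm (a x))\<^sup>2 * (norm (a x))\<^sup>2 \<le> (s * norm x)\<^sup>2 * (norm (a x))\<^sup>2"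
    by (simp add: power2_eq_square algebra_simps)
  then have "(norm (a x))\<^sup>2 \<le> (s * norm x)\<^sup>2"
    by (rule mult_right_le_imp_le) (use False in simp)
  then show ?thesis by (rule power2_le_imp_le) (simp add: assms(2))
qed (simp add: assms(2))

lemma pos_inner_0:
  assumes "pos a" "inner (a x) x = 0"
  shows "a x = 0"
  using pos_cauchy_schwarz[OF assms(1), of x "a x"] assms(2) by simp

lemma in_bicommutantD: "in_bicommutant a b \<Longrightarrow> commute u a \<Longrightarrow> commute u b"
  by (simp add: in_bicommutant_def)

lemma in_bicommutant_self: "in_bicommutant a b \<Longrightarrow> commute a b"
  by (simp add: in_bicommutant_def commute_def)

lemma in_bicommutant_trans: "in_bicommutant a b \<Longrightarrow> in_bicommutant b c \<Longrightarrow> in_bicommutant a c"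
  by (simp add: in_bicommutant_def)

lemma commute_sym: "commute a b \<Longrightarrow> commute b a"
  by (simp add: commute_def)

lemma commute_simps [simp]:
  "commute u 0" "commute u id_blinfun"
  "commute u a \<Longrightarrow> commute u b \<Longrightarrow> commute u (a + b)"
  "commute u a \<Longrightarrow> commute u b \<Longrightarrow> commute u (a - b)"
  "commute u a \<Longrightarrow> commute u (- a)"
  "commute u a \<Longrightarrow> commute u (r *\<^sub>R a)"
  "commute u a \<Longrightarrow> commute u b \<Longrightarrow> commute u (a o\<^sub>L b)"
  by (auto simp: commute_def blinfun.bilinear_simps)

lemma commute_strong_limit:
  fixes b :: "'a::real_inner \<Rightarrow>\<^sub>L 'a"
  assumes "\<And>n. commute u (q n)" "\<And>x. (\<lambda>n. q n x) \<longlonglongrightarrow> b x"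
  shows "commute u b"
  unfolding commute_def
proof
  fix x
  have "(\<lambda>n. u (q n x)) \<longlonglongrightarrow> u (b x)"
    by (intro blinfun.tendsto assms tendsto_const)
  moreover have "(\<lambda>n. u (q n x)) \<longlonglongrightarrow> b (u x)"
    using assms by (simp add: commute_def)
  ultimately show "u (b x) = b (u x)" by (rule LIMSEQ_unique)
qed

lemma selfadj_strong_limit:
  fixes b :: "'a::real_inner \<Rightarrow>\<^sub>L 'a"
  assumes "\<And>n. selfadj (q n)" "\<And>x. (\<lambda>n. q n x) \<longlonglongrightarrow> b x"
  shows "selfadj b"
  unfolding selfadj_def
proof (intro allI)
  fix x y
  have "(\<lambda>n. inner (q n x) y) \<longlonglongrightarrow> inner (b x) y"
    by (intro tendsto_intros assms)
  moreover have "(\<lambda>n. inner (q n x) y) \<longlonglongrightarrow> inner x (b y)"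
    using tendsto_inner[OF tendsto_const assms(2), of x y] assms(1) by (simp add: selfadjD)
  ultimately show "inner (b x) y = inner x (b y)" by (rule LIMSEQ_unique)
qed

lemma proj_strong_limit:
  fixes b :: "'a::real_inner \<Rightarrow>\<^sub>L 'a"
  assumes "\<And>n. proj (q n)" "\<And>x. (\<lambda>n. q n x) \<longlonglongrightarrow> b x"
  shows "proj b"
proof -
  have sa: "selfadj b" using assms selfadj_strong_limit proj_selfadj by blast
  \<comment> \<open>For a projection \<open>inner (q x) (q x) = inner (q x) x\<close>. Both sides
    pass to the strong limit, and the quadratic form determines a self-adjoint operator.\<close>
  have "inner (b (b x)) x = inner (b x) x" for x
  proof -
    have "(\<lambda>n. inner (q n x) (q n x)) \<longlonglongrightarrow> inner (b x) (b x)"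
      by (intro tendsto_intros assms)
    moreover have "(\<lambda>n. inner (q n x) (q n x)) \<longlonglongrightarrow> inner (b x) x"
      using tendsto_inner[OF assms(2) tendsto_const, of x x] assms(1)
      by (simp add: proj_inner power2_norm_eq_inner)
    ultimately show ?thesis using LIMSEQ_unique sa by (metis selfadjD)
  qed
  then have "b o\<^sub>L b = b"
    using sa by (intro selfadj_eqI selfadj_comp) (auto simp: commute_def)
  then show ?thesis using sa by (metis proj_def blinfun_apply_blinfun_compose)
qed

section \<open>Square roots and spectral splittings\<close>

text \<open>Since \<open>b\<close> commutes with \<open>a\<close>, it is one of the operators with
  which \<open>c\<close> must commute. Thus all operators constructed from \<open>a\<close> commute
  with each other.\<close>

lemma in_bicommutant_commute: "in_bicommutant a b \<Longrightarrow> in_bicommutant a c \<Longrightarrow> commute b c"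
  by (meson commute_sym in_bicommutantD in_bicommutant_self)

lemma in_bicommutant_strong_limit:
  fixes b :: "'a::real_inner \<Rightarrow>\<^sub>L 'a"
  assumes "\<And>n. in_bicommutant a (q n)" "\<And>x. (\<lambda>n. q n x) \<longlonglongrightarrow> b x"
  shows "in_bicommutant a b"
  using assms commute_strong_limit unfolding in_bicommutant_def by blast

lemma in_bicommutant_simps [simp]:
  "in_bicommutant u 0" "in_bicommutant u id_blinfun" "in_bicommutant u u"
  "in_bicommutant u a \<Longrightarrow> in_bicommutant u b \<Longrightarrow> in_bicommutant u (a + b)"
  "in_bicommutant u a \<Longrightarrow> in_bicommutant u b \<Longrightarrow> in_bicommutant u (a - b)"
  "in_bicommutant u a \<Longrightarrow> in_bicommutant u (r *\<^sub>R a)"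
  "in_bicommutant u a \<Longrightarrow> in_bicommutant u b \<Longrightarrow> in_bicommutant u (a o\<^sub>L b)"
  by (auto simp: in_bicommutant_def)

lemma selfadj_square: "selfadj b \<Longrightarrow> selfadj (b o\<^sub>L b)"
  by (simp add: selfadj_def)

lemma inner_square: "selfadj b \<Longrightarrow> inner ((b o\<^sub>L b) x) x = (norm (b x))\<^sup>2"
  by (simp add: selfadjD power2_norm_eq_inner)

lemma inner_blinfun_le:
  fixes a :: "'a::real_inner \<Rightarrow>\<^sub>L 'a"
  shows "inner (a x) x \<le> norm a * (norm x)\<^sup>2"
proof -
  have "inner (a x) x \<le> norm (a x) * norm x" by (rule norm_cauchy_schwarz)
  also have "\<dots> \<le> norm a * norm x * norm x" by (intro mult_right_mono norm_blinfun) auto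
  finally show ?thesis by (simp add: power2_eq_square)
qed

section \<open>Existence and uniqueness of positive square roots\<close>

text \<open>Write \<open>a = 1 - c\<close>. Then \<open>1 - z\<close> is a square root exactly if
  \<open>z = (c + z\<^sup>2) / 2\<close>, and this equation is solved by iteration from 0. The
  scalar sequence \<open>t\<close>, the same iteration with 1 in place of \<open>c\<close>,
  majorises the increments of \<open>y\<close>; it is increasing and bounded, so \<open>y\<close>
  converges in norm.\<close>

lemma pos_contraction_sqrt:
  fixes a :: "'a::{real_inner,banach} \<Rightarrow>\<^sub>L 'a"
  assumes "pos a" and le: "\<And>x. inner (a x) x \<le> (norm x)\<^sup>2"
  obtains b where "pos b" "b o\<^sub>L b = a" "in_bicommutant a b"
proof -
  define c where "c = id_blinfun - a"
  have c: "pos c"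
    using assms by (simp add: c_def pos_def blinfun.diff_left inner_diff_left power2_norm_eq_inner)
  have "inner (c x) x \<le> 1 * (norm x)\<^sup>2" for x
    using assms by (simp add: c_def pos_def blinfun.diff_left inner_diff_left power2_norm_eq_inner)
  then have norm_c: "norm c \<le> 1"
    using pos_bound[OF c, of 1] by (intro norm_blinfun_bound) auto
  define t :: "nat \<Rightarrow> real" where "t = rec_nat 0 (\<lambda>_ r. (1 + r\<^sup>2) / 2)"
  define y :: "nat \<Rightarrow> 'a \<Rightarrow>\<^sub>L 'a" where
    "y = rec_nat 0 (\<lambda>_ z. (1/2) *\<^sub>R (c + (z o\<^sub>L z)))"
  have t_simps: "t 0 = 0" "\<And>n. t (Suc n) = (1 + (t n)\<^sup>2) / 2" by (simp_all add: t_def)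
  have y_simps: "y 0 = 0" "\<And>n. y (Suc n) = (1/2) *\<^sub>R (c + (y n o\<^sub>L y n))" by (simp_all add: y_def)
  have t_range: "0 \<le> t n \<and> t n \<le> 1" for n
    by (induction n) (auto simp: t_simps power_le_one)
  have "t n \<le> t (Suc n)" for n
  proof -
    have "0 \<le> (1 - t n)\<^sup>2" by simp
    then show ?thesis by (simp add: t_simps power2_eq_square algebra_simps)
  qed
  then have "incseq t" by (rule incseq_SucI)
  have "Cauchy t"
    using incseq_convergent[OF \<open>incseq t\<close>, of 1] t_range by (metis LIMSEQ_imp_Cauchy)
  have bic: "in_bicommutant c (y n)" for n
    by (induction n) (simp_all add: y_simps)
  have sa: "selfadj (y n)" for n
    by (induction n) (use c in \<open>simp_all add: y_simps selfadj_square pos_def\<close>)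
  have norm_y: "norm (y n) \<le> t n" for n
  proof (induction n)
    case (Suc n)
    have "norm (y (Suc n)) \<le> (norm c + norm (y n o\<^sub>L y n)) / 2"
      by (simp add: y_simps norm_triangle_ineq)
    also have "\<dots> \<le> (1 + t n * t n) / 2"
      using norm_c norm_blinfun_compose[of "y n" "y n"] mult_mono[OF Suc Suc] t_range[of n] by simp
    finally show ?case by (simp add: t_simps power2_eq_square)
  qed (simp add: y_simps t_simps)
  have diff: "norm (y m - y n) \<le> t m - t n" if "n \<le> m" for m n
    using that
  proof (induction n arbitrary: m)
    case 0
    then show ?case using norm_y by (simp add: y_simps t_simps)
  next
    case (Suc n)
    then obtain k where k: "m = Suc k" "n \<le> k" by (cases m) auto
    \<comment> \<open>Difference of two squares; it factors because the iterates commute, all being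
      in the bicommutant of \<open>c\<close>. The scalar sequence factors in the same way.\<close>
    have "y m - y (Suc n) = (1/2) *\<^sub>R ((y k - y n) o\<^sub>L (y k + y n))"
    proof (rule blinfun_eqI)
      fix x
      have "y k (y n x) = y n (y k x)"
        using in_bicommutant_commute[OF bic bic] by (simp add: commute_def)
      then show "(y m - y (Suc n)) x = ((1/2) *\<^sub>R ((y k - y n) o\<^sub>L (y k + y n))) x"
        by (simp add: k y_simps blinfun.bilinear_simps algebra_simps)
    qed
    then have "norm (y m - y (Suc n)) \<le> (norm (y k - y n) * norm (y k + y n)) / 2"
      using norm_blinfun_compose[of "y k - y n" "y k + y n"] by simp
    also have "\<dots> \<le> ((t k - t n) * (t k + t n)) / 2"
      using Suc.IH[OF k(2)] norm_triangle_ineq[of "y k" "y n"] norm_y[of k] norm_y[of n] t_range[of n] t_range[of k]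
        incseqD[OF \<open>incseq t\<close> k(2)]
      by (intro divide_right_mono mult_mono) auto
    also have "\<dots> = t m - t (Suc n)"
      by (simp add: k t_simps power2_eq_square algebra_simps flip: diff_divide_distrib)
    finally show ?case .
  qed
  have "Cauchy y"
  proof (rule metric_CauchyI)
    fix e :: real assume "0 < e"
    then obtain N where N: "\<And>m n. m \<ge> N \<Longrightarrow> n \<ge> N \<Longrightarrow> dist (t m) (t n) < e"
      using \<open>Cauchy t\<close> by (meson metric_CauchyD)
    have "dist (y m) (y n) < e" if "m \<ge> N" "n \<ge> N" for m n
    proof (cases "n \<le> m")
      case True
      then show ?thesis using diff[OF True] N[OF that] by (simp add: dist_norm)
    next
      case False
      then have "dist (y n) (y m) \<le> t n - t m" using diff[of m n] by (simp add: dist_norm)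
      then show ?thesis using N[OF that] by (simp add: dist_commute dist_real_def)
    qed
    then show "\<exists>N. \<forall>m\<ge>N. \<forall>n\<ge>N. dist (y m) (y n) < e" by blast
  qed
  then obtain z where z: "y \<longlonglongrightarrow> z" using Cauchy_convergent convergent_def by blast
  then have zx: "(\<lambda>n. y n x) \<longlonglongrightarrow> z x" for x
    by (intro blinfun.tendsto tendsto_const)
  have "(\<lambda>n. y (Suc n)) \<longlonglongrightarrow> (1/2) *\<^sub>R (c + (z o\<^sub>L z))"
    unfolding y_simps
    by (intro tendsto_intros bounded_bilinear.tendsto[OF bounded_bilinear_blinfun_compose] z)
  then have fixpoint: "z = (1/2) *\<^sub>R (c + (z o\<^sub>L z))"
    using z LIMSEQ_Suc LIMSEQ_unique by blast
  have "selfadj z" using selfadj_strong_limit sa zx by blast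
  have "norm (y n) \<le> 1" for n using norm_y[of n] t_range[of n] by linarith
  then have "norm z \<le> 1" using LIMSEQ_le_const2[OF tendsto_norm[OF z]] by blast
  have "inner (z x) x \<le> (norm x)\<^sup>2" for x
    using inner_blinfun_le[of z x] mult_right_mono[OF \<open>norm z \<le> 1\<close>, of "(norm x)\<^sup>2"] by simp
  then have "pos (id_blinfun - z)"
    using \<open>selfadj z\<close> by (simp add: pos_def blinfun.diff_left inner_diff_left power2_norm_eq_inner)
  moreover have "(id_blinfun - z) o\<^sub>L (id_blinfun - z) = a"
  proof (rule blinfun_eqI)
    fix x
    have "2 *\<^sub>R z x = c x + z (z x)"
      using arg_cong[OF fixpoint, of "\<lambda>f. 2 *\<^sub>R blinfun_apply f x"] by (simp add: blinfun.bilinear_simps)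
    then show "((id_blinfun - z) o\<^sub>L (id_blinfun - z)) x = a x"
      by (simp add: c_def blinfun.bilinear_simps scaleR_2 algebra_simps)
  qed
  moreover have "in_bicommutant a (id_blinfun - z)"
    using in_bicommutant_strong_limit[OF bic zx] in_bicommutant_trans[of a c z] by (simp add: c_def)
  ultimately show thesis using that by blast
qed

lemma pos_sqrt:
  fixes a :: "'a::{real_inner,banach} \<Rightarrow>\<^sub>L 'a"
  assumes "pos a"
  obtains b where "pos b" "b o\<^sub>L b = a" "in_bicommutant a b"
proof -
  \<comment> \<open>The summand 1 keeps \<open>K\<close> positive even for
    \<open>a = 0\<close>.\<close>
  define K where "K = norm a + 1"
  have K: "K > 0" by (simp add: K_def add_nonneg_pos)
  define a' where "a' = (1/K) *\<^sub>R a"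
  have "pos a'" using assms K by (simp add: a'_def pos_def blinfun.scaleR_left)
  moreover have "inner (a' x) x \<le> (norm x)\<^sup>2" for x
  proof -
    have "inner (a x) x \<le> K * (norm x)\<^sup>2"
      using inner_blinfun_le[of a x] by (simp add: K_def distrib_right add_increasing2)
    then show ?thesis using K by (simp add: a'_def blinfun.scaleR_left field_simps)
  qed
  ultimately obtain b' where b': "pos b'" "b' o\<^sub>L b' = a'" "in_bicommutant a' b'"
    using pos_contraction_sqrt by blast
  define b where "b = sqrt K *\<^sub>R b'"
  have "pos b" using b' K by (simp add: b_def pos_def blinfun.scaleR_left)
  moreover have "b o\<^sub>L b = a"
  proof -
    have "b o\<^sub>L b = K *\<^sub>R (b' o\<^sub>L b')"
      using K by (intro blinfun_eqI) (simp add: b_def blinfun.bilinear_simps)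
    then show ?thesis using K by (simp add: b' a'_def)
  qed
  moreover have "in_bicommutant a b"
    using in_bicommutant_trans[of a a' b'] b' by (simp add: a'_def b_def)
  ultimately show thesis using that by blast
qed

text \<open>Any positive root \<open>u\<close> of \<open>h\<close> is compared with the root
  \<open>r\<close> from the bicommutant, with which it commutes. For \<open>y = (u - r) x\<close>
  this gives \<open>(u + r) y = 0\<close>; both forms at \<open>y\<close> are nonnegative, so
  \<open>u y = r y = 0\<close>, and therefore
  \<open>(norm ((u - r) x))\<^sup>2 = inner ((u - r) y) x = 0\<close>.\<close>

lemma pos_sqrt_unique:
  fixes s t :: "'a::{real_inner,banach} \<Rightarrow>\<^sub>L 'a"
  assumes "pos s" "pos t" "s o\<^sub>L s = t o\<^sub>L t"
  shows "s = t"
proof -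
  define h where "h = s o\<^sub>L s"
  have "pos h"
    using assms inner_square[of s] by (simp add: h_def pos_def selfadj_square)
  then obtain r where r: "pos r" "r o\<^sub>L r = h" "in_bicommutant h r"
    using pos_sqrt by blast
  have unique: "u = r" if u: "pos u" "u o\<^sub>L u = h" for u
  proof -
    have eq: "u (u x) = r (r x)" for x using u r by (metis blinfun_apply_blinfun_compose)
    have "commute u h" by (simp add: commute_def flip: u(2))
    then have cm: "u (r x) = r (u x)" for x using r(3) by (metis commute_def in_bicommutantD)
    have d: "u (u x - r x) = r (u x - r x)" for x
    proof -
      define y where "y = u x - r x"
      have "u y + r y = 0"
        by (simp add: y_def blinfun.diff_right eq cm)
      then have "inner (u y) y + inner (r y) y = 0" by (metis inner_add_left inner_zero_left)
      then have "inner (u y) y = 0" "inner (r y) y = 0"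
        using pos_ge_0[OF u(1), of y] pos_ge_0[OF r(1), of y] by linarith+
      then show ?thesis using pos_inner_0 u(1) r(1) unfolding y_def by metis
    qed
    have "norm (u x - r x) = 0" for x
    proof -
      have sa: "selfadj (u - r)" using u r by (simp add: pos_selfadj)
      have "(norm ((u - r) x))\<^sup>2 = inner ((u - r) ((u - r) x)) x"
        using inner_square[OF sa, of x] by simp
      then show ?thesis using d[of x] by (simp add: blinfun.diff_left)
    qed
    then show ?thesis by (intro blinfun_eqI) simp
  qed
  show ?thesis using unique[OF assms(1)] unique[OF assms(2)] assms(3) by (simp add: h_def)
qed

section \<open>Powers of a positive contraction and kernel projections\<close>

primrec opow :: "('a::real_normed_vector \<Rightarrow>\<^sub>L 'a) \<Rightarrow> nat \<Rightarrow> ('a \<Rightarrow>\<^sub>L 'a)" where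
  "opow c 0 = id_blinfun"
| "opow c (Suc n) = c o\<^sub>L opow c n"

lemma opow_add: "opow c (m + n) x = opow c m (opow c n x)"
  by (induction m) auto

lemma in_bicommutant_opow: "in_bicommutant c (opow c n)"
  by (induction n) simp_all

lemma selfadj_opow: "selfadj c \<Longrightarrow> selfadj (opow c n)"
proof (induction n)
  case (Suc n)
  then show ?case
    using in_bicommutant_self[OF in_bicommutant_opow] by (auto intro: selfadj_comp)
qed simp

text \<open>With the square root \<open>g\<close> of \<open>c\<close>,
  \<open>inner (opow c n x) x = (norm (opow g n x))\<^sup>2\<close>. This is nonnegative, and it
  decreases in \<open>n\<close> because \<open>g\<close> is a contraction.\<close>

lemma pos_opow:
  fixes c :: "'a::{real_inner,banach} \<Rightarrow>\<^sub>L 'a"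
  assumes "pos c" "\<And>x. inner (c x) x \<le> (norm x)\<^sup>2"
  shows "pos (opow c n)" and "inner (opow c (Suc n) x) x \<le> inner (opow c n x) x"
proof -
  obtain g where g: "pos g" "g o\<^sub>L g = c" using pos_sqrt[OF assms(1)] by blast
  have sa: "selfadj (opow g n)" for n using g by (simp add: pos_selfadj selfadj_opow)
  have sq: "opow c n = opow g n o\<^sub>L opow g n" for n
  proof (induction n)
    case (Suc n)
    have "g (opow g n x) = opow g n (g x)" for x
      using in_bicommutant_self[OF in_bicommutant_opow, of g n] by (simp add: commute_def)
    moreover have "c x = g (g x)" for x using g(2) by auto
    ultimately show ?case using Suc by (intro blinfun_eqI) simp
  qed (rule blinfun_eqI, simp)
  have inner_eq: "inner (opow c n x) x = (norm (opow g n x))\<^sup>2" for n x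
    unfolding sq by (rule inner_square[OF sa])
  show "pos (opow c n)"
    using assms(1) by (simp add: pos_def selfadj_opow inner_eq)
  have norm_mono: "(norm (g z))\<^sup>2 \<le> (norm z)\<^sup>2" for z
    using assms(2)[of z] inner_square[of g z] g by (simp add: pos_selfadj)
  show "inner (opow c (Suc n) x) x \<le> inner (opow c n x) x"
    using norm_mono[of "opow g n x"] unfolding inner_eq by simp
qed

lemma opow_contraction:
  fixes c :: "'a::real_normed_vector \<Rightarrow>\<^sub>L 'a"
  assumes "\<And>x. norm (c x) \<le> norm x"
  shows "norm (opow c n x) \<le> norm x"
  by (induction n) (auto intro: order_trans assms)

text \<open>The powers converge to the projection onto the fixed space of \<open>c\<close>. With
  \<open>s k = inner (opow c k x) x\<close>, a decreasing nonnegative sequence, the squared distance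
  of the powers \<open>m\<close> and \<open>n\<close> at \<open>x\<close> is
  \<open>s (2 * m) - 2 * s (m + n) + s (2 * n)\<close>, so they form a Cauchy sequence.\<close>

lemma opow_strong_limit:
  fixes c :: "'a::{real_inner,banach} \<Rightarrow>\<^sub>L 'a"
  assumes "pos c" "\<And>x. inner (c x) x \<le> (norm x)\<^sup>2"
  obtains N where "proj N" "in_bicommutant c N" "\<And>x. (\<lambda>n. opow c n x) \<longlonglongrightarrow> N x"
    "\<And>x. c (N x) = N x" "\<And>x. c x = x \<Longrightarrow> N x = x"
proof -
  have conv: "convergent (\<lambda>n. opow c n x)" for x
  proof -
    define s where "s k = inner (opow c k x) x" for k
    have "decseq s"
      by (rule decseq_SucI) (use pos_opow(2)[OF assms] in \<open>simp add: s_def\<close>)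
    moreover have "0 \<le> s k" for k using pos_opow(1)[OF assms] by (simp add: s_def pos_ge_0)
    ultimately have "Cauchy s" by (metis LIMSEQ_imp_Cauchy decseq_convergent)
    have dist: "(norm (opow c m x - opow c n x))\<^sup>2 = (s (m + m) - s (m + n)) + (s (n + n) - s (m + n))"
      for m n
    proof -
      have "inner (opow c i x) (opow c j x) = s (i + j)" for i j
        using selfadj_opow[OF pos_selfadj[OF assms(1)], of i]
        by (simp add: s_def add.commute[of i] opow_add selfadjD) (metis opow_add add.commute inner_commute selfadjD)
      then show ?thesis
        by (simp add: power2_norm_eq_inner inner_diff add.commute)
    qed
    have "Cauchy (\<lambda>n. opow c n x)"
    proof (rule metric_CauchyI)
      fix e :: real assume "0 < e"
      then have "0 < e\<^sup>2 / 2" by simp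
      then obtain N where N: "\<And>m n. m \<ge> N \<Longrightarrow> n \<ge> N \<Longrightarrow> dist (s m) (s n) < e\<^sup>2 / 2"
        using \<open>Cauchy s\<close> metric_CauchyD by blast
      have "dist (opow c m x) (opow c n x) < e" if "m \<ge> N" "n \<ge> N" for m n
      proof -
        have "s (m + m) - s (m + n) < e\<^sup>2 / 2" "s (n + n) - s (m + n) < e\<^sup>2 / 2"
          using N[of "m + m" "m + n"] N[of "n + n" "m + n"] that
          by (simp_all only: dist_real_def abs_less_iff trans_le_add1)
        then have "(norm (opow c m x - opow c n x))\<^sup>2 < e\<^sup>2" unfolding dist by argo
        then show ?thesis
          unfolding dist_norm by (rule power2_less_imp_less) (use \<open>0 < e\<close> in simp)
      qed
      then show "\<exists>N. \<forall>m\<ge>N. \<forall>n\<ge>N. dist (opow c m x) (opow c n x) < e" by blast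
    qed
    then show ?thesis by (rule Cauchy_convergent)
  qed
  have "norm (c x) \<le> norm x" for x using pos_bound[OF assms(1), of 1 x] assms(2) by simp
  then obtain N :: "'a \<Rightarrow>\<^sub>L 'a" where N: "\<And>x. (\<lambda>n. opow c n x) \<longlonglongrightarrow> N x"
    using strong_limit_exists[OF conv opow_contraction] by blast
  have sa: "selfadj N"
    using selfadj_strong_limit[OF selfadj_opow[OF pos_selfadj[OF assms(1)]] N] .
  have cN: "c (N x) = N x" for x
  proof -
    have "(\<lambda>n. c (opow c n x)) \<longlonglongrightarrow> c (N x)" by (intro blinfun.tendsto N tendsto_const)
    moreover have "(\<lambda>n. c (opow c n x)) \<longlonglongrightarrow> N x" using LIMSEQ_Suc[OF N[of x]] by simp
    ultimately show ?thesis by (rule LIMSEQ_unique)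
  qed
  have fixed: "N x = x" if "c x = x" for x
  proof -
    have "opow c n x = x" for n by (induction n) (auto simp: that)
    then show ?thesis using LIMSEQ_unique[OF N[of x]] by auto
  qed
  show thesis
    using that[OF _ in_bicommutant_strong_limit[OF in_bicommutant_opow N] N cN fixed] sa cN fixed
    by (simp add: proj_def)
qed

text \<open>The kernel of \<open>h\<close> is the fixed space of
  \<open>c = 1 - h\<^sup>2 / K\<close>, since \<open>h (h x) = 0\<close> implies
  \<open>h x = 0\<close> for self-adjoint \<open>h\<close>. The choice of \<open>K\<close> makes
  \<open>c\<close> a positive contraction.\<close>

lemma kernel_projection:
  fixes h :: "'a::{real_inner,banach} \<Rightarrow>\<^sub>L 'a"
  assumes "selfadj h"
  obtains N where "proj N" "in_bicommutant h N" "\<And>x. h (N x) = 0" "\<And>x. h x = 0 \<Longrightarrow> N x = x"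
proof -
  define K where "K = (norm h)\<^sup>2 + 1"
  have K: "K > 0" by (simp add: K_def add_nonneg_pos)
  define c where "c = id_blinfun - (1/K) *\<^sub>R (h o\<^sub>L h)"
  have inner_c: "inner (c x) x = (norm x)\<^sup>2 - (1/K) * (norm (h x))\<^sup>2" for x
    using inner_square[OF assms, of x]
    by (simp add: c_def blinfun.bilinear_simps inner_diff_left power2_norm_eq_inner)
  have "(norm (h x))\<^sup>2 \<le> K * (norm x)\<^sup>2" for x
  proof -
    have "(norm (h x))\<^sup>2 \<le> (norm h * norm x)\<^sup>2" by (intro power_mono norm_blinfun) auto
    then show ?thesis by (simp add: K_def power_mult_distrib distrib_right add_increasing2)
  qed
  then have c_pos: "pos c"
    using K by (simp add: pos_def inner_c field_simps) (simp add: c_def assms selfadj_square)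
  have c_le: "inner (c x) x \<le> (norm x)\<^sup>2" for x using K by (simp add: inner_c)
  obtain N where N: "proj N" "in_bicommutant c N" "\<And>x. c (N x) = N x" "\<And>x. c x = x \<Longrightarrow> N x = x"
    by (rule opow_strong_limit[OF c_pos c_le], rule that)
  have "h (N x) = 0" for x
  proof -
    have "h (h (N x)) = 0" using N(3)[of x] K by (simp add: c_def blinfun.bilinear_simps)
    then show ?thesis using inner_square[OF assms, of "N x"] by simp
  qed
  moreover have "N x = x" if "h x = 0" for x
    using that by (intro N(4)) (simp add: c_def blinfun.bilinear_simps)
  moreover have "in_bicommutant h N" using N(2) in_bicommutant_trans[of h c N] by (simp add: c_def)
  ultimately show thesis using that N(1) by blast
qed

text \<open>The spectral projection of \<open>a\<close> for \<open>(-\<infinity>, s]\<close> is the only such \<open>p\<close> that commutes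
  with \<open>a\<close>.\<close>

definition splits_at :: "('a::real_inner \<Rightarrow>\<^sub>L 'a) \<Rightarrow> real \<Rightarrow> ('a \<Rightarrow>\<^sub>L 'a) \<Rightarrow> bool" where
  "splits_at a s p \<longleftrightarrow> proj p \<and>
     (\<forall>x. p x = x \<longrightarrow> inner (a x) x \<le> s * (norm x)\<^sup>2) \<and>
     (\<forall>x. p x = 0 \<and> x \<noteq> 0 \<longrightarrow> s * (norm x)\<^sup>2 < inner (a x) x)"

text \<open>Put \<open>d = a - s\<close> and \<open>m = |d|\<close>; \<open>p\<close> projects onto
  the kernel of \<open>m + d\<close>, where \<open>d = - m\<close> has nonpositive form. Since
  \<open>(m + d) (m - d) = 0\<close>, \<open>p\<close> fixes the range of \<open>m - d\<close>, so
  \<open>m = d\<close> on the kernel of \<open>p\<close> and the form is nonnegative there. It is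
  strictly positive: a zero would give \<open>m x = d x = 0\<close>, hence
  \<open>p x = x\<close>.\<close>

lemma splits_at_exists:
  fixes a :: "'a::{real_inner,banach} \<Rightarrow>\<^sub>L 'a"
  assumes "selfadj a"
  obtains p where "splits_at a s p" "in_bicommutant a p"
proof -
  define d where "d = a - s *\<^sub>R id_blinfun"
  have sa: "selfadj d" by (simp add: d_def assms)
  then have "pos (d o\<^sub>L d)" using inner_square[OF sa] by (simp add: pos_def selfadj_square)
  then obtain m where m: "pos m" "m o\<^sub>L m = d o\<^sub>L d" "in_bicommutant (d o\<^sub>L d) m"
    using pos_sqrt by blast
  have bic_m: "in_bicommutant d m" using in_bicommutant_trans[OF _ m(3), of d] by simp
  define h where "h = m + d"
  have "selfadj h" using m sa by (simp add: h_def pos_selfadj)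
  then obtain p where p: "proj p" "in_bicommutant h p" "\<And>x. h (p x) = 0" "\<And>x. h x = 0 \<Longrightarrow> p x = x"
    using kernel_projection by blast
  have bic_p: "in_bicommutant d p" using in_bicommutant_trans[OF _ p(2), of d] bic_m by (simp add: h_def)
  have inner_d: "inner (d x) x = inner (a x) x - s * (norm x)\<^sup>2" for x
    by (simp add: d_def blinfun.bilinear_simps inner_diff_left power2_norm_eq_inner)
  have hm: "h (m x - d x) = 0" for x
  proof -
    have "m (m x) = d (d x)" using m(2) by (metis blinfun_apply_blinfun_compose)
    moreover have "d (m x) = m (d x)" using in_bicommutant_self[OF bic_m] by (simp add: commute_def)
    ultimately show ?thesis by (simp add: h_def blinfun.bilinear_simps)
  qed
  have below: "inner (a x) x \<le> s * (norm x)\<^sup>2" if "p x = x" for x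
  proof -
    have "m x + d x = 0" using p(3)[of x] that by (simp add: h_def blinfun.add_left)
    then have "inner (m x) x + inner (d x) x = 0" by (metis inner_add_left inner_zero_left)
    then show ?thesis using pos_ge_0[OF m(1), of x] by (simp add: inner_d)
  qed
  have above: "s * (norm x)\<^sup>2 < inner (a x) x" if "p x = 0" "x \<noteq> 0" for x
  proof -
    have "m x - d x = p (m x - d x)" using p(4)[OF hm] by simp
    also have "\<dots> = m (p x) - d (p x)"
      using in_bicommutant_commute[OF bic_m bic_p] in_bicommutant_self[OF bic_p]
      by (simp add: commute_def blinfun.diff_right)
    finally have eq: "m x = d x" by (simp add: that)
    then have "0 \<le> inner (d x) x" using pos_ge_0[OF m(1), of x] by simp
    moreover have "inner (d x) x \<noteq> 0"
    proof
      assume "inner (d x) x = 0"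
      then have "m x = 0" using pos_inner_0[OF m(1), of x] by (simp add: eq)
      then have "p x = x" using eq by (intro p(4)) (simp add: h_def blinfun.add_left)
      then show False using that by simp
    qed
    ultimately show ?thesis by (simp add: inner_d)
  qed
  have "in_bicommutant a p" using in_bicommutant_trans[OF _ bic_p, of a] by (simp add: d_def)
  moreover have "splits_at a s p" using p(1) below above by (simp add: splits_at_def)
  ultimately show thesis using that by blast
qed

text \<open>The vector \<open>y = p x - q (p x)\<close> lies in the range of \<open>p\<close> and in
  the kernel of \<open>q\<close>. If it were nonzero, its form would be at most \<open>s\<close> and
  greater than \<open>t\<close>, both times \<open>(norm y)\<^sup>2\<close>.\<close>

lemma splits_at_mono:
  assumes "splits_at a s p" "splits_at a t q" "s \<le> t" "commute p q"
  shows "q (p x) = p x"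
proof -
  define y where "y = p x - q (p x)"
  have "p y = y"
    using assms by (simp add: y_def splits_at_def proj_def commute_def blinfun.diff_right)
  moreover have "q y = 0"
    using assms by (simp add: y_def splits_at_def proj_def blinfun.diff_right)
  moreover have "s * (norm y)\<^sup>2 \<le> t * (norm y)\<^sup>2" using assms(3) by (simp add: mult_right_mono)
  ultimately have "y = 0" using assms(1,2) unfolding splits_at_def by (meson not_less order_trans)
  then show ?thesis by (simp add: y_def)
qed

lemma splits_at_unique:
  assumes "splits_at a s p" "splits_at a s q" "commute p q"
  shows "p = q"
proof (rule blinfun_eqI)
  fix x
  show "p x = q x"
    using splits_at_mono[OF assms(1,2) order_refl assms(3), of x]
      splits_at_mono[OF assms(2,1) order_refl commute_sym[OF assms(3)], of x] assms(3)
    by (simp add: commute_def)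
qed

section \<open>The spectral theorem for self-adjoint operators\<close>

text \<open>At \<open>q x\<close> the hypothesis reads \<open>(norm (p (q x)))\<^sup>2 + (norm (q
  x))\<^sup>2 \<le> (norm (q x))\<^sup>2\<close>.\<close>

lemma proj_orthogonal:
  assumes "proj p" "proj q" "\<And>x. inner (p x) x + inner (q x) x \<le> (norm x)\<^sup>2"
  shows "p (q x) = 0"
  using assms(3)[of "q x"] proj_inner[OF assms(1), of "q x"] proj_idem[OF assms(2), of x]
  by (metis add_le_same_cancel2 inner_eq_zero_iff power2_norm_eq_inner power2_less_eq_zero_iff norm_eq_zero)

lemma proj_add:
  assumes "proj p" "proj q" "\<And>x. p (q x) = 0"
  shows "proj (p + q)"
proof -
  have "q (p x) = 0" for x
  proof -
    have "inner (q (p x)) y = inner x (p (q y))" for y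
      using assms(1,2) by (simp add: proj_selfadj selfadjD)
    then show ?thesis using assms(3) by (metis inner_eq_zero_iff inner_zero_right)
  qed
  then show ?thesis
    using assms by (simp add: proj_def blinfun.add_left blinfun.add_right)
qed

lemma proj_diff:
  assumes "proj p" "proj q" "\<And>x. q (p x) = p x" "\<And>x. p (q x) = p x"
  shows "proj (q - p)"
  using assms by (simp add: proj_def blinfun.diff_left blinfun.diff_right)

text \<open>For \<open>m \<le> n\<close> the squared distance of \<open>q n x\<close> and
  \<open>q m x\<close> is the increment of the bounded increasing sequence
  \<open>inner (q n x) x\<close>.\<close>

lemma incseq_proj_strong_limit:
  fixes q :: "nat \<Rightarrow> 'a::{real_inner,banach} \<Rightarrow>\<^sub>L 'a"
  assumes q: "\<And>n. proj (q n)" and mono: "\<And>m n x. m \<le> n \<Longrightarrow> q n (q m x) = q m x"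
  obtains b :: "'a \<Rightarrow>\<^sub>L 'a" where "proj b" "\<And>x. (\<lambda>n. q n x) \<longlonglongrightarrow> b x"
proof -
  have conv: "convergent (\<lambda>n. q n x)" for x
  proof -
    define s where "s n = inner (q n x) x" for n
    have dist: "(norm (q n x - q m x))\<^sup>2 = s n - s m" if "m \<le> n" for m n
    proof -
      have *: "inner (q n x) (q m x) = inner (q m x) x"
        using selfadjD[OF proj_selfadj[OF q], of n x "q m x"] mono[OF that]
        by (simp add: inner_commute)
      have "inner (q k x) (q k x) = inner (q k x) x" for k
        using proj_inner[OF q] by (simp add: power2_norm_eq_inner)
      then show ?thesis
        using * by (simp add: power2_norm_eq_inner inner_diff s_def inner_commute[of "q m x" "q n x"])
    qed
    have "incseq s"
    proof (rule incseq_SucI)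
      show "s n \<le> s (Suc n)" for n using dist[of n "Suc n"] zero_le_power2 by (metis diff_ge_0_iff_ge le_SucI order_refl)
    qed
    moreover have "s n \<le> (norm x)\<^sup>2" for n
      using proj_inner[OF q, of n x] proj_norm_le[OF q, of n x] by (simp add: s_def)
    ultimately have "Cauchy s" by (metis LIMSEQ_imp_Cauchy incseq_convergent)
    have "Cauchy (\<lambda>n. q n x)"
    proof (rule metric_CauchyI)
      fix e :: real assume "0 < e"
      then have "0 < e\<^sup>2" by simp
      then obtain N where N: "\<And>m n. m \<ge> N \<Longrightarrow> n \<ge> N \<Longrightarrow> dist (s m) (s n) < e\<^sup>2"
        using \<open>Cauchy s\<close> metric_CauchyD by blast
      have *: "dist (q n x) (q m x) < e" if "m \<ge> N" "m \<le> n" for m n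
      proof -
        have "s n - s m < e\<^sup>2"
          using N[of n m] that by (simp add: dist_real_def abs_less_iff)
        then have "(norm (q n x - q m x))\<^sup>2 < e\<^sup>2" using dist[OF that(2)] by simp
        then show ?thesis
          unfolding dist_norm by (rule power2_less_imp_less) (use \<open>0 < e\<close> in simp)
      qed
      then have "dist (q m x) (q n x) < e" if "m \<ge> N" "n \<ge> N" for m n
        using that by (metis dist_commute nat_le_linear)
      then show "\<exists>N. \<forall>m\<ge>N. \<forall>n\<ge>N. dist (q m x) (q n x) < e" by blast
    qed
    then show ?thesis by (rule Cauchy_convergent)
  qed
  then obtain b :: "'a \<Rightarrow>\<^sub>L 'a" where "\<And>x. (\<lambda>n. q n x) \<longlonglongrightarrow> b x"
    using strong_limit_exists[OF conv proj_norm_le[OF q]] by blast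
  then show thesis using that proj_strong_limit[of q, OF q] by blast
qed

text \<open>Cut the interval into \<open>n + 1\<close> equal pieces. The bounds on the pieces
  telescope in \<open>G\<close> and sum to \<open>(B - A) * (G B - G A) / (n + 1)\<close>. This
  takes the place of Riemann-Stieltjes sums when the operator is represented as an integral.\<close>

lemma constant_of_superlinear_increments:
  fixes D G :: "real \<Rightarrow> real"
  assumes "A \<le> B"
    and bound: "\<And>u v. A \<le> u \<Longrightarrow> u \<le> v \<Longrightarrow> v \<le> B \<Longrightarrow> \<bar>D v - D u\<bar> \<le> (v - u) * (G v - G u)"
  shows "D A = D B"
proof -
  have bd: "\<bar>D B - D A\<bar> \<le> ((B - A) * (G B - G A)) / real (Suc n)" for n
  proof -
    define h where "h = (B - A) / real (Suc n)"
    define pt where "pt i = A + real i * h" for i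
    have h: "h \<ge> 0" using assms(1) by (simp add: h_def)
    have pt0: "pt 0 = A" and ptn: "pt (Suc n) = B" by (simp_all add: pt_def h_def)
    have step: "\<bar>D (pt (Suc i)) - D (pt i)\<bar> \<le> h * (G (pt (Suc i)) - G (pt i))" if "i < Suc n" for i
    proof -
      have "real (Suc i) * h \<le> real (Suc n) * h" using that h by (intro mult_right_mono) auto
      also have "\<dots> = B - A" by (simp add: h_def)
      finally have "pt (Suc i) \<le> B" by (simp add: pt_def)
      moreover have "A \<le> pt i" "pt i \<le> pt (Suc i)" "pt (Suc i) - pt i = h"
        using h by (simp_all add: pt_def algebra_simps)
      ultimately show ?thesis using bound by metis
    qed
    have "\<bar>D B - D A\<bar> = \<bar>\<Sum>i<Suc n. D (pt (Suc i)) - D (pt i)\<bar>"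
      using sum_lessThan_telescope[of "\<lambda>i. D (pt i)" "Suc n"] by (simp only: pt0 ptn)
    also have "\<dots> \<le> (\<Sum>i<Suc n. \<bar>D (pt (Suc i)) - D (pt i)\<bar>)" by (rule sum_abs)
    also have "\<dots> \<le> (\<Sum>i<Suc n. h * (G (pt (Suc i)) - G (pt i)))"
      by (intro sum_mono step) simp
    also have "\<dots> = h * (G B - G A)"
      using sum_lessThan_telescope[of "\<lambda>i. G (pt i)" "Suc n"]
      by (simp only: sum_distrib_left[symmetric] pt0 ptn)
    finally show ?thesis by (simp add: h_def)
  qed
  have "(\<lambda>n. ((B - A) * (G B - G A)) / real (Suc n)) \<longlonglongrightarrow> 0"
    using LIMSEQ_Suc[OF lim_const_over_n] by simp
  then have "\<bar>D B - D A\<bar> \<le> 0"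
    using LIMSEQ_le_const bd by blast
  then show ?thesis by simp
qed

section \<open>The right-continuous resolution of the identity\<close>

locale selfadj_op =
  fixes a :: "'a::{real_inner,banach} \<Rightarrow>\<^sub>L 'a"
  assumes sa: "selfadj a"
begin

text \<open>Membership in the bicommutant makes the projections for different \<open>s\<close>
  commute, and by \<open>splits_at_unique\<close> it leaves only one candidate.\<close>

definition res :: "real \<Rightarrow> 'a \<Rightarrow>\<^sub>L 'a" where
  "res s = (SOME p. splits_at a s p \<and> in_bicommutant a p)"

lemma res: "splits_at a s (res s)" "in_bicommutant a (res s)"
proof -
  have "\<exists>p. splits_at a s p \<and> in_bicommutant a p" using splits_at_exists[OF sa] by metis
  then have "splits_at a s (res s) \<and> in_bicommutant a (res s)" unfolding res_def by (rule someI_ex)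
  then show "splits_at a s (res s)" "in_bicommutant a (res s)" by auto
qed

lemma res_proj: "proj (res s)" and res_le: "res s x = x \<Longrightarrow> inner (a x) x \<le> s * (norm x)\<^sup>2"
  and res_greater: "res s x = 0 \<Longrightarrow> x \<noteq> 0 \<Longrightarrow> s * (norm x)\<^sup>2 < inner (a x) x"
  using res(1)[of s] by (auto simp: splits_at_def)

lemma res_commute: "commute (res s) (res t)"
  using in_bicommutant_commute res(2) by blast

lemma res_mono: "s \<le> t \<Longrightarrow> res t (res s x) = res s x" "s \<le> t \<Longrightarrow> res s (res t x) = res s x"
  using splits_at_mono[OF res(1) res(1) _ res_commute] res_commute by (auto simp: commute_def)

lemma res_diff_proj: "s \<le> t \<Longrightarrow> proj (res t - res s)"
  by (intro proj_diff res_proj res_mono)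

lemma res_eq_0: "s < - norm a \<Longrightarrow> res s = 0"
proof (rule blinfun_eqI)
  fix x assume "s < - norm a"
  define y where "y = res s x"
  have "inner (a y) y \<le> s * (norm y)\<^sup>2" by (rule res_le) (simp add: y_def proj_idem res_proj)
  moreover have "- norm a * (norm y)\<^sup>2 \<le> inner (a y) y"
    using inner_blinfun_le[of "- a" y] by (simp add: blinfun.minus_left)
  ultimately have "(- norm a - s) * (norm y)\<^sup>2 \<le> 0" by (simp add: algebra_simps)
  then show "res s x = blinfun_apply 0 x" using \<open>s < - norm a\<close> by (simp add: mult_le_0_iff y_def)
qed

lemma res_eq_id: "norm a \<le> s \<Longrightarrow> res s = id_blinfun"
proof (rule blinfun_eqI)
  fix x assume "norm a \<le> s"
  define y where "y = x - res s x"
  have "res s y = 0" by (simp add: y_def proj_idem res_proj blinfun.diff_right)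
  moreover have "inner (a y) y \<le> s * (norm y)\<^sup>2"
    using inner_blinfun_le[of a y] mult_right_mono[OF \<open>norm a \<le> s\<close>, of "(norm y)\<^sup>2"] by simp
  ultimately have "y = 0" using res_greater by (meson not_less)
  then show "res s x = blinfun_apply id_blinfun x" by (simp add: y_def)
qed

text \<open>The decreasing projections have a strong limit \<open>p\<close>. It splits
  \<open>a\<close> at \<open>s\<close> and lies in the bicommutant, so uniqueness identifies it with
  \<open>res s\<close>.\<close>

lemma res_right_limit: "(\<lambda>n. res (s + 1 / real (Suc n)) x) \<longlonglongrightarrow> res s x"
proof -
  define t where "t n = s + 1 / real (Suc n)" for n
  have t_antimono: "t n \<le> t m" if "m \<le> n" for m n
    using that by (simp add: t_def frac_le)
  have t_ge: "s \<le> t n" for n by (simp add: t_def)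
  \<comment> \<open>The complements increase, so the limit of increasing projections applies to
    them.\<close>
  obtain b where b: "proj b" "\<And>x. (\<lambda>n. (id_blinfun - res (t n)) x) \<longlonglongrightarrow> b x"
  proof (rule incseq_proj_strong_limit)
    show "proj (id_blinfun - res (t n))" for n by (intro proj_compl res_proj)
    show "(id_blinfun - res (t n)) ((id_blinfun - res (t m)) x) = (id_blinfun - res (t m)) x"
      if "m \<le> n" for m n x
      using res_mono[OF t_antimono[OF that]] by (simp add: blinfun.diff_left blinfun.diff_right)
  qed blast
  define p where "p = id_blinfun - b"
  have lim: "(\<lambda>n. res (t n) x) \<longlonglongrightarrow> p x" for x
    using tendsto_diff[OF tendsto_const[of x] b(2)[of x]] by (simp add: p_def blinfun.diff_left)
  have "proj p" unfolding p_def by (rule proj_compl[OF b(1)])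
  have "in_bicommutant a p" by (rule in_bicommutant_strong_limit[OF res(2) lim])
  then have cm: "commute p (res s)" using in_bicommutant_commute res(2) by blast
  have "splits_at a s p"
    unfolding splits_at_def
  proof (intro conjI allI impI)
    show "proj p" by fact
  next
    fix x assume "p x = x"
    have "inner (a x) x \<le> t n * (norm x)\<^sup>2" for n
    proof (rule res_le)
      have "(\<lambda>m. res (t n) (res (t m) x)) \<longlonglongrightarrow> res (t n) (p x)"
        by (intro blinfun.tendsto lim tendsto_const)
      moreover have "(\<lambda>m. res (t n) (res (t m) x)) \<longlonglongrightarrow> p x"
      proof (rule Lim_transform_eventually[OF lim])
        show "\<forall>\<^sub>F m in sequentially. res (t m) x = res (t n) (res (t m) x)"
          using eventually_ge_at_top[of n] by eventually_elim (simp add: res_mono t_antimono)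
      qed
      ultimately show "res (t n) x = x" using LIMSEQ_unique \<open>p x = x\<close> by metis
    qed
    moreover have "(\<lambda>n. t n * (norm x)\<^sup>2) \<longlonglongrightarrow> (s + 0) * (norm x)\<^sup>2"
      unfolding t_def by (intro tendsto_intros LIMSEQ_Suc lim_1_over_n)
    ultimately show "inner (a x) x \<le> s * (norm x)\<^sup>2"
      using LIMSEQ_le_const[of _ "s * (norm x)\<^sup>2"] by auto
  next
    \<comment> \<open>A strict inequality would not survive the limit. Instead \<open>p\<close>
      fixes the range of \<open>res s\<close>, so \<open>p x = 0\<close> forces
      \<open>res s x = 0\<close>, and \<open>res_greater\<close> applies at \<open>s\<close>
      itself.\<close>
    fix x assume x: "p x = 0 \<and> x \<noteq> 0"
    have "(\<lambda>n. res (t n) (res s x)) \<longlonglongrightarrow> p (res s x)" by (rule lim)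
    then have "(\<lambda>n. res s x) \<longlonglongrightarrow> p (res s x)" by (simp add: res_mono t_ge)
    then have "res s x = p (res s x)" using LIMSEQ_unique tendsto_const by blast
    also have "\<dots> = 0" using cm x by (simp add: commute_def)
    finally show "s * (norm x)\<^sup>2 < inner (a x) x" using x by (intro res_greater) auto
  qed
  then have "p = res s" using splits_at_unique res(1) cm by blast
  then show ?thesis using lim by (simp add: t_def)
qed

definition dist_fun :: "'a \<Rightarrow> real \<Rightarrow> real" where
  "dist_fun x s = inner (res s x) x"

lemma dist_fun_diff: "s \<le> t \<Longrightarrow> dist_fun x t - dist_fun x s = (norm ((res t - res s) x))\<^sup>2"
  using proj_inner[OF res_diff_proj, of s t x]
  by (simp add: dist_fun_def blinfun.diff_left inner_diff_left)

lemma dist_fun_mono: "s \<le> t \<Longrightarrow> dist_fun x s \<le> dist_fun x t"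
  using dist_fun_diff[of s t x] by (simp add: diff_eq_eq)

lemma dist_fun_right_cont: "continuous (at_right s) (dist_fun x)"
proof (rule continuous_at_right_real_increasing[THEN iffD2, OF dist_fun_mono], assumption, intro allI impI)
  fix e :: real assume "0 < e"
  have "(\<lambda>n. dist_fun x (s + 1 / real (Suc n))) \<longlonglongrightarrow> dist_fun x s"
    unfolding dist_fun_def by (intro tendsto_intros res_right_limit)
  then have "\<forall>\<^sub>F n in sequentially. dist (dist_fun x (s + 1 / real (Suc n))) (dist_fun x s) < e"
    using \<open>0 < e\<close> by (rule tendstoD)
  then obtain n where "dist (dist_fun x (s + 1 / real (Suc n))) (dist_fun x s) < e"
    by (auto simp: eventually_sequentially)
  then have "dist_fun x (s + 1 / real (Suc n)) - dist_fun x s < e" by (simp add: dist_real_def)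
  then show "\<exists>d>0. dist_fun x (s + d) - dist_fun x s < e" by (intro exI[of _ "1 / real (Suc n)"]) simp
qed

section \<open>Stieltjes measures and the projections that represent them\<close>

definition mu :: "'a \<Rightarrow> real measure" where
  "mu x = interval_measure (dist_fun x)"

lemma sets_mu [simp, measurable_cong]: "sets (mu x) = sets borel" and space_mu [simp]: "space (mu x) = UNIV"
  by (simp_all add: mu_def)

lemma emeasure_mu_Ioc: "s \<le> t \<Longrightarrow> emeasure (mu x) {s<..t} = ennreal (dist_fun x t - dist_fun x s)"
  unfolding mu_def by (rule emeasure_interval_measure_Ioc[OF _ dist_fun_mono dist_fun_right_cont])

lemma measure_mu_Ioc: "s \<le> t \<Longrightarrow> measure (mu x) {s<..t} = dist_fun x t - dist_fun x s"
  using emeasure_mu_Ioc[of s t x] dist_fun_mono[of s t x] by (simp add: measure_def)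

lemma emeasure_mu_UNIV: "emeasure (mu x) UNIV = ennreal ((norm x)\<^sup>2)"
proof -
  have "(\<lambda>n. emeasure (mu x) {- real n<..real n}) \<longlonglongrightarrow> emeasure (mu x) (\<Union>n::nat. {- real n<..real n})"
    by (rule Lim_emeasure_incseq) (auto simp: incseq_def)
  \<comment> \<open>As soon as \<open>n\<close> exceeds \<open>norm a\<close>, \<open>res\<close> is
    0 at the left end and the identity at the right end.\<close>
  moreover have "\<forall>\<^sub>F n in sequentially. emeasure (mu x) {- real n<..real n} = ennreal ((norm x)\<^sup>2)"
    using eventually_ge_at_top[of "nat \<lceil>norm a\<rceil> + 1"]
  proof eventually_elim
    case (elim n)
    then have "norm a < real n" by linarith
    then show ?case
      by (simp add: emeasure_mu_Ioc dist_fun_def res_eq_0 res_eq_id power2_norm_eq_inner)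
  qed
  then have "(\<lambda>n. emeasure (mu x) {- real n<..real n}) \<longlonglongrightarrow> ennreal ((norm x)\<^sup>2)"
    by (rule tendsto_eventually)
  moreover have "(\<Union>n::nat. {- real n<..real n}) = UNIV"
  proof (intro equalityI subsetI UNIV_I UN_I)
    fix t :: real
    show "t \<in> {- real (nat \<lceil>\<bar>t\<bar>\<rceil> + 1)<..real (nat \<lceil>\<bar>t\<bar>\<rceil> + 1)}"
      by simp linarith
  qed
  ultimately show ?thesis using LIMSEQ_unique by metis
qed

lemma finite_mu: "finite_measure (mu x)"
  by standard (simp add: emeasure_mu_UNIV)

lemma measure_mu_UNIV: "measure (mu x) UNIV = (norm x)\<^sup>2"
  by (simp add: measure_def emeasure_mu_UNIV)

text \<open>Dynkin argument: the half-open intervals are stable under intersection, and the sets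
  whose measure comes from a projection are closed under complements and countable disjoint unions.
  For the unions, the projections are orthogonal because two disjoint sets have total mass at most
  \<open>(norm x)\<^sup>2\<close>, and their partial sums increase to a projection.\<close>

lemma mu_projection_exists:
  assumes "B \<in> sets borel"
  shows "\<exists>p. proj p \<and> in_bicommutant a p \<and> (\<forall>x. measure (mu x) B = inner (p x) x)"
proof -
  let ?G = "range (\<lambda>(s, t). {s<..t::real})"
  have borel: "sets borel = sigma_sets UNIV ?G"
    by (subst borel_sigma_sets_Ioc) simp
  have "Int_stable ?G"
    unfolding Int_stable_def
  proof (intro ballI)
    fix A B assume "A \<in> ?G" "B \<in> ?G"
    then obtain s t u v where "A = {s<..t}" "B = {u<..v}" by auto
    then have "A \<inter> B = (\<lambda>(s, t). {s<..t}) (max s u, min t v)" by auto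
    then show "A \<inter> B \<in> ?G" by (rule range_eqI)
  qed
  moreover have "?G \<subseteq> Pow UNIV" by simp
  moreover have "B \<in> sigma_sets UNIV ?G" using assms borel by simp
  ultimately show ?thesis
  proof (induction rule: sigma_sets_induct_disjoint)
    case (basic A)
    then obtain s t where A: "A = {s<..t}" by auto
    show ?case
    proof (cases "s \<le> t")
      case True
      then show ?thesis
        using res(2) by (intro exI[of _ "res t - res s"])
          (simp add: A res_diff_proj measure_mu_Ioc dist_fun_def blinfun.diff_left inner_diff_left)
    next
      case False
      then show ?thesis by (intro exI[of _ 0]) (simp add: A proj_def)
    qed
  next
    case empty
    then show ?case by (intro exI[of _ 0]) (simp add: proj_def)
  next
    case (compl A)
    then obtain p where p: "proj p" "in_bicommutant a p" "\<And>x. measure (mu x) A = inner (p x) x" by blast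
    have "measure (mu x) (UNIV - A) = inner ((id_blinfun - p) x) x" for x
      using finite_measure.finite_measure_compl[OF finite_mu, of A x] compl(1) p(3)[of x]
      by (simp add: borel measure_mu_UNIV blinfun.diff_left inner_diff_left power2_norm_eq_inner)
    then show ?case using p by (intro exI[of _ "id_blinfun - p"]) (simp add: proj_compl)
  next
    case (union A)
    then have "\<forall>i. \<exists>p. proj p \<and> in_bicommutant a p \<and> (\<forall>x. measure (mu x) (A i) = inner (p x) x)"
      by blast
    from choice[OF this] obtain p where p: "\<And>i. proj (p i)" "\<And>i. in_bicommutant a (p i)"
        "\<And>i x. measure (mu x) (A i) = inner (p i x) x" by blast
    have Ab: "A i \<in> sets borel" for i using union(2) borel by auto
    have orth: "p i (p j x) = 0" if "i \<noteq> j" for i j x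
    proof (rule proj_orthogonal[OF p(1) p(1)])
      fix x
      have "A i \<inter> A j = {}" using union(1) that by (auto simp: disjoint_family_on_def)
      then have "measure (mu x) (A i) + measure (mu x) (A j) = measure (mu x) (A i \<union> A j)"
        using finite_measure.finite_measure_Union[OF finite_mu] Ab by simp
      also have "\<dots> \<le> (norm x)\<^sup>2"
        unfolding measure_mu_UNIV[symmetric]
        by (rule finite_measure.finite_measure_mono[OF finite_mu]) auto
      finally show "inner (p i x) x + inner (p j x) x \<le> (norm x)\<^sup>2" by (simp add: p(3))
    qed
    define q where "q n = (\<Sum>i<n. p i)" for n
    have q_apply: "q n x = (\<Sum>i<n. p i x)" for n x by (simp add: q_def blinfun.sum_left)
    have pq: "p n (q m x) = 0" if "m \<le> n" for m n x
      unfolding q_apply blinfun.sum_right using that by (intro sum.neutral) (auto simp: orth)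
    have qp: "q m (p n x) = (if n < m then p n x else 0)" for m n x
    proof -
      have "q m (p n x) = (\<Sum>i<m. if i = n then p n x else 0)"
        unfolding q_apply by (intro sum.cong) (auto simp: orth proj_idem p(1))
      then show ?thesis by simp
    qed
    have proj_q: "proj (q n)" for n
    proof (induction n)
      case 0
      then show ?case by (simp add: q_def proj_def)
    next
      case (Suc n)
      have "q (Suc n) = p n + q n" by (simp add: q_def)
      then show ?case using proj_add[OF p(1) Suc] pq by simp
    qed
    have q_mono: "q n (q m x) = q m x" if "m \<le> n" for m n x
      unfolding q_apply[of m] blinfun.sum_right using that by (intro sum.cong) (auto simp: qp)
    obtain b where b: "proj b" "\<And>x. (\<lambda>n. q n x) \<longlonglongrightarrow> b x"
    proof (rule incseq_proj_strong_limit[of q, OF proj_q q_mono])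
      fix b assume "proj b" "\<And>x. (\<lambda>n. q n x) \<longlonglongrightarrow> b x"
      then show thesis by (rule that)
    qed
    have "in_bicommutant a (q n)" for n by (induction n) (simp_all add: q_def p(2))
    then have "in_bicommutant a b" using b(2) by (rule in_bicommutant_strong_limit)
    moreover have "measure (mu x) (\<Union>i. A i) = inner (b x) x" for x
    proof -
      have "(\<lambda>n. inner (q n x) x) \<longlonglongrightarrow> inner (b x) x" by (intro tendsto_intros b(2))
      then have "(\<lambda>i. inner (p i x) x) sums inner (b x) x"
        by (simp add: sums_def q_apply inner_sum_left)
      moreover have "(\<lambda>i. measure (mu x) (A i)) sums measure (mu x) (\<Union>i. A i)"
        using Ab union(1) by (intro finite_measure.finite_measure_UNION[OF finite_mu]) auto
      ultimately show ?thesis by (simp add: p(3) sums_unique2)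
    qed
    ultimately show ?case using b(1) by (intro exI[of _ b]) simp
  qed
qed

text \<open>On Borel sets the choice is unique, since the quadratic form determines a self-adjoint
  operator. Identities between the measures thus become identities between the projections.\<close>

definition spec :: "real set \<Rightarrow> 'a \<Rightarrow>\<^sub>L 'a" where
  "spec B = (SOME p. proj p \<and> in_bicommutant a p \<and> (\<forall>x. measure (mu x) B = inner (p x) x))"

lemma spec:
  assumes "B \<in> sets borel"
  shows "proj (spec B)" "in_bicommutant a (spec B)" "measure (mu x) B = inner (spec B x) x"
proof -
  have "proj (spec B) \<and> in_bicommutant a (spec B) \<and> (\<forall>x. measure (mu x) B = inner (spec B x) x)"
    unfolding spec_def by (rule someI_ex[OF mu_projection_exists[OF assms]])
  then show "proj (spec B)" "in_bicommutant a (spec B)" "measure (mu x) B = inner (spec B x) x"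
    by blast+
qed

lemma emeasure_mu: "B \<in> sets borel \<Longrightarrow> emeasure (mu x) B = ennreal (inner (spec B x) x)"
  by (simp add: finite_measure.emeasure_eq_measure[OF finite_mu] spec(3))

lemma spec_UNIV: "spec UNIV = id_blinfun"
proof (rule selfadj_eqI)
  show "selfadj (spec UNIV)" by (simp add: spec proj_selfadj)
  show "inner (spec UNIV x) x = inner (id_blinfun x) x" for x
    using spec(3)[of UNIV x] by (simp add: measure_mu_UNIV power2_norm_eq_inner)
qed simp

lemma spec_Un:
  assumes "A \<in> sets borel" "B \<in> sets borel" "A \<inter> B = {}"
  shows "spec (A \<union> B) = spec A + spec B"
proof (rule selfadj_eqI)
  show "selfadj (spec (A \<union> B))" "selfadj (spec A + spec B)"
    using assms by (auto simp: spec proj_selfadj)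
  show "inner (spec (A \<union> B) x) x = inner ((spec A + spec B) x) x" for x
    using finite_measure.finite_measure_Union[OF finite_mu, of A x B] assms
    by (simp add: spec(3) blinfun.add_left inner_add_left)
qed

lemma spec_disjoint:
  assumes "A \<in> sets borel" "B \<in> sets borel" "A \<inter> B = {}"
  shows "spec A (spec B x) = 0"
proof (rule proj_orthogonal)
  show "proj (spec A)" "proj (spec B)" using assms by (auto simp: spec)
  show "inner (spec A x) x + inner (spec B x) x \<le> (norm x)\<^sup>2" for x
  proof -
    have "inner (spec A x) x + inner (spec B x) x = inner (spec (A \<union> B) x) x"
      using spec_Un[OF assms] by (simp add: blinfun.add_left inner_add_left)
    also have "\<dots> = (norm (spec (A \<union> B) x))\<^sup>2" using assms by (intro proj_inner spec) auto
    also have "\<dots> \<le> (norm x)\<^sup>2" using assms by (intro power_mono proj_norm_le spec) auto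
    finally show ?thesis .
  qed
qed

text \<open>Split both sets along \<open>A \<inter> B\<close>; projections of disjoint sets multiply
  to zero, so of the four products only the square of the common part survives.\<close>

lemma spec_Int:
  assumes "A \<in> sets borel" "B \<in> sets borel"
  shows "spec (A \<inter> B) = spec A o\<^sub>L spec B"
proof (rule blinfun_eqI)
  fix x
  have sets: "A \<inter> B \<in> sets borel" "A - B \<in> sets borel" "B - A \<in> sets borel"
    using assms by auto
  have "A \<inter> B \<union> (A - B) = A" "A \<inter> B \<union> (B - A) = B" by auto
  then have AB: "spec A = spec (A \<inter> B) + spec (A - B)" "spec B = spec (A \<inter> B) + spec (B - A)"
    using spec_Un[OF sets(1) sets(2)] spec_Un[OF sets(1) sets(3)] by auto
  have disj: "spec (A \<inter> B) (spec (B - A) x) = 0" "spec (A - B) (spec (A \<inter> B) x) = 0"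
    "spec (A - B) (spec (B - A) x) = 0"
    by (rule spec_disjoint; use sets in auto)+
  have "spec A (spec B x) = spec (A \<inter> B) (spec (A \<inter> B) x)"
    unfolding AB blinfun.add_left blinfun.add_right disj by simp
  then show "spec (A \<inter> B) x = (spec A o\<^sub>L spec B) x"
    using assms by (simp add: spec proj_idem)
qed

lemma spec_sums:
  assumes A: "range A \<subseteq> sets borel" "disjoint_family A"
  shows "(\<lambda>n. spec (A n) x) sums spec (\<Union>n. A n) x"
proof -
  define U where "U n = (\<Union>i<n. A i)" for n
  define V where "V = (\<Union>n. A n)"
  have meas: "A n \<in> sets borel" "U n \<in> sets borel" "V \<in> sets borel" for n
    using A(1) by (auto simp: U_def V_def intro!: sets.finite_UN)
  have sum: "(\<Sum>i<n. spec (A i) x) = spec (U n) x" for n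
  proof (induction n)
    case 0
    have "spec {} x = 0"
      using spec_disjoint[of "{}" "{}" x] proj_idem[OF spec(1), of "{}" x] by simp
    then show ?case by (simp add: U_def)
  next
    case (Suc n)
    have "U n \<inter> A n = {}"
    proof -
      have "A i \<inter> A n = {}" if "i < n" for i
        using disjoint_family_onD[OF A(2), of i n] that by simp
      then show ?thesis by (auto simp: U_def)
    qed
    moreover have "U (Suc n) = U n \<union> A n" by (auto simp: U_def less_Suc_eq)
    ultimately show ?case using Suc spec_Un[of "U n" "A n"] meas by (simp add: blinfun.add_left)
  qed
  \<comment> \<open>Strong convergence of the partial sums is thereby reduced to countable
    additivity of the scalar measure.\<close>
  have norm_eq: "(norm (spec V x - spec (U n) x))\<^sup>2 = measure (mu x) V - measure (mu x) (U n)" for n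
  proof -
    have "U n \<union> (V - U n) = V" by (auto simp: U_def V_def)
    then have V: "spec V = spec (U n) + spec (V - U n)"
      using spec_Un[of "U n" "V - U n"] meas by (metis Diff_disjoint sets.Diff)
    then show ?thesis
      using proj_inner[OF spec(1), of "V - U n" x] meas
      by (simp add: spec(3) blinfun.add_left inner_add_left)
  qed
  have "(\<lambda>n. \<Sum>i<n. measure (mu x) (A i)) \<longlonglongrightarrow> measure (mu x) V"
    using finite_measure.finite_measure_UNION[OF finite_mu, of A x] A by (simp add: sums_def V_def)
  moreover have "(\<Sum>i<n. measure (mu x) (A i)) = measure (mu x) (U n)" for n
    using meas by (simp add: spec(3) sum[symmetric] inner_sum_left)
  ultimately have "(\<lambda>n. measure (mu x) V - measure (mu x) (U n)) \<longlonglongrightarrow> 0"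
    using tendsto_diff[OF tendsto_const[of "measure (mu x) V"], of "\<lambda>n. measure (mu x) (U n)" "measure (mu x) V"]
    by simp
  then have "(\<lambda>n. sqrt ((norm (spec V x - spec (U n) x))\<^sup>2)) \<longlonglongrightarrow> sqrt 0"
    unfolding norm_eq by (rule tendsto_real_sqrt)
  then have "(\<lambda>n. norm (spec V x - spec (U n) x)) \<longlonglongrightarrow> 0" by simp
  then have "(\<lambda>n. spec V x - spec (U n) x) \<longlonglongrightarrow> 0" by (rule tendsto_norm_zero_cancel)
  then have "(\<lambda>n. spec V x - (spec V x - spec (U n) x)) \<longlonglongrightarrow> spec V x - 0"
    by (intro tendsto_diff tendsto_const)
  then show ?thesis by (simp add: sums_def sum V_def)
qed

lemma AE_mu: "AE t in mu x. - norm a - 1 < t \<and> t \<le> norm a"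
proof (rule AE_I')
  \<comment> \<open>The extra 1 is there because \<open>res\<close> is known to vanish only strictly
    below \<open>- norm a\<close>.\<close>
  let ?I = "{- norm a - 1<..norm a}"
  have "measure (mu x) ?I = (norm x)\<^sup>2"
    using norm_ge_zero[of a]
    by (subst measure_mu_Ioc, linarith) (auto simp: dist_fun_def res_eq_0 res_eq_id power2_norm_eq_inner)
  then have "measure (mu x) (UNIV - ?I) = 0"
    using finite_measure.finite_measure_compl[OF finite_mu, of ?I x] by (simp add: measure_mu_UNIV)
  then show "UNIV - ?I \<in> null_sets (mu x)"
    by (simp add: null_sets_def finite_measure.emeasure_eq_measure[OF finite_mu])
  show "{t \<in> space (mu x). \<not> (- norm a - 1 < t \<and> t \<le> norm a)} \<subseteq> UNIV - ?I" by auto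
qed

lemma integrable_mu: "integrable (mu x) (\<lambda>t. t)"
proof (rule finite_measure.integrable_const_bound[OF finite_mu])
  show "AE t in mu x. norm t \<le> norm a + 1"
    using AE_mu[of x] by (rule eventually_mono) (auto simp: abs_le_iff)
qed simp

lemma integrable_mu_indicator: "B \<in> sets borel \<Longrightarrow> integrable (mu x) (\<lambda>t. t * indicator B t)"
  by (intro integrable_mult_indicator[of B "mu x" "\<lambda>t. t", simplified] integrable_real_mult_indicator integrable_mu) simp

text \<open>\<open>D\<close> compares the form of \<open>a\<close> cut off at \<open>s\<close> with
  the integral cut off at \<open>s\<close>. On an interval from \<open>u\<close> to \<open>v\<close>
  of mass \<open>m\<close> both increments lie between \<open>u * m\<close> and
  \<open>v * m\<close>, so \<open>D\<close> changes by at most \<open>(v - u) * m\<close> and is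
  constant. It vanishes left of the spectrum, and at \<open>norm a\<close> it is the difference of
  the two sides.\<close>

lemma inner_eq_integral: "inner (a x) x = (\<integral>t. t \<partial>mu x)"
proof -
  define D where "D s = inner (a (res s x)) x - (\<integral>t. t * indicator {..s} t \<partial>mu x)" for s
  have "\<bar>D v - D u\<bar> \<le> (v - u) * (dist_fun x v - dist_fun x u)" if "u \<le> v" for u v
  proof -
    define m where "m = dist_fun x v - dist_fun x u"
    define w where "w = (res v - res u) x"
    have m: "m = (norm w)\<^sup>2" unfolding m_def w_def by (rule dist_fun_diff[OF that])
    \<comment> \<open>\<open>w\<close> lies in the range of the projection
      \<open>res v - res u\<close>, which commutes with \<open>a\<close> and can be moved to the
      other side.\<close>
    have "inner (a w) w = inner (a w) x"
    proof -
      have "commute a (res v - res u)" using in_bicommutant_self[OF res(2)] by simp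
      then have "(res v - res u) (a w) = a ((res v - res u) w)" by (simp add: commute_def)
      also have "(res v - res u) w = w" unfolding w_def by (rule proj_idem[OF res_diff_proj[OF that]])
      finally show ?thesis
        using selfadjD[OF proj_selfadj[OF res_diff_proj[OF that]], of "a w" x] by (simp add: w_def)
    qed
    moreover have "inner (a w) w \<le> v * m"
      unfolding m by (rule res_le) (use res_mono[OF that] res_proj in \<open>simp add: w_def blinfun.diff_left blinfun.diff_right proj_idem\<close>)
    moreover have "u * m \<le> inner (a w) w"
    proof (cases "w = 0")
      case False
      have "res u w = 0"
        using res_mono[OF that] res_proj by (simp add: w_def blinfun.diff_left blinfun.diff_right proj_idem)
      then show ?thesis using res_greater[OF _ False, of u] by (simp add: m)
    qed (simp add: m)
    moreover have "inner (a (res v x)) x - inner (a (res u x)) x = inner (a w) x"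
      by (simp add: w_def blinfun.diff_left blinfun.diff_right inner_diff_left)
    moreover have "(\<integral>t. t * indicator {..v} t \<partial>mu x) - (\<integral>t. t * indicator {..u} t \<partial>mu x)
        = (\<integral>t. t * indicator {u<..v} t \<partial>mu x)"
      by (subst Bochner_Integration.integral_diff[symmetric];
          (rule integrable_mu_indicator)?; (rule Bochner_Integration.integral_cong)?)
        (use that in \<open>auto simp: indicator_def\<close>)
    moreover have int_const: "integrable (mu x) (\<lambda>t. c * indicator {u<..v} t)" for c :: real
      by (intro finite_measure.integrable_const_bound[OF finite_mu, where B = "\<bar>c\<bar>"])
        (auto simp: indicator_def)
    moreover have const: "(\<integral>t. c * indicator {u<..v} t \<partial>mu x) = c * m" for c :: real
      using measure_mu_Ioc[OF that] by (simp add: m_def)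
    moreover have "u * m \<le> (\<integral>t. t * indicator {u<..v} t \<partial>mu x)"
      unfolding const[symmetric]
      by (intro integral_mono int_const integrable_mu_indicator) (auto simp: indicator_def)
    moreover have "(\<integral>t. t * indicator {u<..v} t \<partial>mu x) \<le> v * m"
      unfolding const[symmetric]
      by (intro integral_mono int_const integrable_mu_indicator) (auto simp: indicator_def)
    ultimately show ?thesis
      unfolding D_def m_def[symmetric] left_diff_distrib by linarith
  qed
  then have "D (- norm a - 1) = D (norm a)"
    using norm_ge_zero[of a]
    by (intro constant_of_superlinear_increments[where D = D and G = "dist_fun x"]) (linarith, blast)
  moreover have "(\<integral>t. t * indicator {..- norm a - 1} t \<partial>mu x) = 0"
    using AE_mu[of x] by (intro integral_eq_zero_AE, elim eventually_mono) (auto simp: indicator_def)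
  moreover have "(\<integral>t. t * indicator {..norm a} t \<partial>mu x) = (\<integral>t. t \<partial>mu x)"
  proof (rule integral_cong_AE)
    show "AE t in mu x. t * indicator {..norm a} t = t"
      using AE_mu[of x] by (rule eventually_mono) (auto simp: indicator_def)
  qed simp_all
  ultimately show ?thesis by (simp add: D_def res_eq_0 res_eq_id)
qed

end

section \<open>Complex operators and their spectral measures\<close>

instance chilbert_space \<subseteq> banach ..

lemma cinner_scaleC_right: "cinner x (c *\<^sub>C y) = cnj c * cinner x y"
  by (metis cinner_commute cinner_scaleC_left complex_cnj_cnj complex_cnj_mult)

lemma inner_scaleC_left: "inner (c *\<^sub>C x) y = inner x (cnj c *\<^sub>C y)"
  by (simp add: inner_eq_Re_cinner cinner_scaleC_right cinner_scaleC_left)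

text \<open>Reduces identities for \<open>cinner\<close> to identities for \<open>inner\<close>
  alone.\<close>

lemma Im_cinner: "Im (cinner x y) = inner x (\<i> *\<^sub>C y)"
  by (simp add: inner_eq_Re_cinner cinner_scaleC_right)

lemma cinner_self: "cinner x x = complex_of_real ((norm x)\<^sup>2)"
proof (rule complex_eqI)
  show "Im (cinner x x) = Im (complex_of_real ((norm x)\<^sup>2))"
    using arg_cong[OF cinner_commute[of x x], of Im] by simp
qed (simp add: power2_norm_eq_inner inner_eq_Re_cinner)

lemma norm_scaleC: "norm (c *\<^sub>C x) = cmod c * norm x"
proof -
  have "complex_of_real ((norm (c *\<^sub>C x))\<^sup>2) = (c * cnj c) * complex_of_real ((norm x)\<^sup>2)"
    unfolding cinner_self[symmetric] by (simp add: cinner_scaleC_left cinner_scaleC_right)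
  also have "\<dots> = complex_of_real ((cmod c * norm x)\<^sup>2)"
    unfolding complex_norm_square[symmetric] by (simp add: power_mult_distrib)
  finally have "(norm (c *\<^sub>C x))\<^sup>2 = (cmod c * norm x)\<^sup>2" by (simp only: of_real_eq_iff)
  then show ?thesis by (simp add: power2_eq_iff_nonneg)
qed

lemma bounded_linear_scaleC: "bounded_linear (\<lambda>x. c *\<^sub>C x)"
proof (rule bounded_linear_intro[where K = "cmod c"])
  show "c *\<^sub>C r *\<^sub>R x = r *\<^sub>R c *\<^sub>C x" for r x
    by (simp add: scaleR_scaleC scaleC_scaleC mult.commute)
qed (simp_all add: scaleC_add_right norm_scaleC mult.commute)

definition scaleC_op :: "complex \<Rightarrow> 'h::chilbert_space \<Rightarrow>\<^sub>L 'h" where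
  "scaleC_op c = Blinfun (\<lambda>x. c *\<^sub>C x)"

lemma scaleC_op_apply [simp]: "blinfun_apply (scaleC_op c) x = c *\<^sub>C x"
  by (simp add: scaleC_op_def bounded_linear_Blinfun_apply bounded_linear_scaleC)

text \<open>Writing complex linearity as commutation makes it inheritable through
  \<open>in_bicommutant\<close>.\<close>

lemma bounded_ops_iff: "a \<in> bounded_ops \<longleftrightarrow> (\<forall>c. commute (scaleC_op c) a)"
  by (auto simp: bounded_ops_def commute_def)

lemma bounded_opsD: "a \<in> bounded_ops \<Longrightarrow> a (c *\<^sub>C x) = c *\<^sub>C a x"
  by (simp add: bounded_ops_def)

lemma bounded_ops_bicommutant: "a \<in> bounded_ops \<Longrightarrow> in_bicommutant a b \<Longrightarrow> b \<in> bounded_ops"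
  by (simp add: bounded_ops_iff in_bicommutant_def)

text \<open>The real adjoint of a complex-linear operator is itself complex-linear and therefore
  serves as the complex adjoint; uniqueness already follows from real parts.\<close>

lemma adj_eqI:
  fixes b :: "'h::chilbert_space \<Rightarrow>\<^sub>L 'h"
  assumes a: "a \<in> bounded_ops" and b: "\<And>x y. inner (a x) y = inner x (b y)"
  shows "adj a = b" "b \<in> bounded_ops"
proof -
  have lin: "b (c *\<^sub>C y) = c *\<^sub>C b y" for c y
  proof (rule vector_eq_ldot[THEN iffD1], rule allI)
    fix x
    have "inner x (c *\<^sub>C b y) = inner (a (cnj c *\<^sub>C x)) y"
      by (simp add: b inner_scaleC_left)
    also have "\<dots> = inner x (b (c *\<^sub>C y))"
      by (simp add: bounded_opsD[OF a] inner_scaleC_left b)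
    finally show "inner x (b (c *\<^sub>C y)) = inner x (c *\<^sub>C b y)" by simp
  qed
  then show "b \<in> bounded_ops" by (simp add: bounded_ops_def)
  show "adj a = b"
    unfolding adj_def
  proof (rule the_equality)
    show "\<forall>x y. cinner (a x) y = cinner x (b y)"
      by (simp add: complex_eq_iff Im_cinner b lin flip: inner_eq_Re_cinner)
    fix b' :: "'h \<Rightarrow>\<^sub>L 'h" assume b': "\<forall>x y. cinner (a x) y = cinner x (b' y)"
    have "b' y = b y" for y
    proof (rule vector_eq_ldot[THEN iffD1], rule allI)
      show "inner x (b' y) = inner x (b y)" for x
        using b' unfolding b[symmetric] by (simp add: inner_eq_Re_cinner)
    qed
    then show "b' = b" by (intro blinfun_eqI)
  qed
qed

lemma adj:
  fixes a :: "'h::chilbert_space \<Rightarrow>\<^sub>L 'h"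
  assumes "a \<in> bounded_ops"
  shows "adj a \<in> bounded_ops" "inner (a x) y = inner x (adj a y)"
proof -
  obtain b :: "'h \<Rightarrow>\<^sub>L 'h" where "\<And>x y. inner (a x) y = inner x (b y)"
    using adjoint_exists[of a] by metis
  then show "adj a \<in> bounded_ops" "inner (a x) y = inner x (adj a y)"
    using adj_eqI[OF assms, of b] by auto
qed

lemma adj_selfadj_iff: "a \<in> bounded_ops \<Longrightarrow> adj a = a \<longleftrightarrow> selfadj a"
  using adj[of a] adj_eqI[of a a] by (metis selfadj_def)

lemma projection_iff: "projection p \<longleftrightarrow> p \<in> bounded_ops \<and> proj p"
proof -
  have "p o\<^sub>L p = p \<longleftrightarrow> (\<forall>x. p (p x) = p x)"
    by (auto intro: blinfun_eqI dest: arg_cong[where f = "\<lambda>f. blinfun_apply f x" for x])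
  then show ?thesis by (auto simp: projection_def proj_def adj_selfadj_iff)
qed

text \<open>Moving \<open>a\<close> and the imaginary unit across the inner product shows that the
  imaginary part equals its own negative.\<close>

lemma selfadj_inner_cinner:
  assumes "a \<in> bounded_ops" "selfadj a"
  shows "cinner (a x) x = complex_of_real (inner (a x) x)"
proof -
  have "inner (a x) (\<i> *\<^sub>C x) = inner (\<i> *\<^sub>C x) (a x)" by (rule inner_commute)
  also have "\<dots> = inner x (cnj \<i> *\<^sub>C a x)" by (rule inner_scaleC_left)
  also have "cnj \<i> *\<^sub>C a x = a (cnj \<i> *\<^sub>C x)" using assms bounded_opsD by metis
  also have "inner x (a (cnj \<i> *\<^sub>C x)) = inner (a x) (cnj \<i> *\<^sub>C x)" using assms selfadjD by metis
  also have "cnj \<i> *\<^sub>C x = (-1) *\<^sub>R \<i> *\<^sub>C x" by (simp add: scaleR_scaleC scaleC_scaleC)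
  finally have "inner (a x) (\<i> *\<^sub>C x) = 0" by simp
  then show ?thesis by (simp add: complex_eq_iff Im_cinner inner_eq_Re_cinner)
qed

lemma positive_op_iff: "positive_op a \<longleftrightarrow> a \<in> bounded_ops \<and> pos a"
proof (intro iffI conjI)
  assume pos: "positive_op a"
  then show a: "a \<in> bounded_ops" by (simp add: positive_op_def)
  have im: "inner (a x) (\<i> *\<^sub>C x) = 0" and nonneg: "0 \<le> inner (a x) x" for x
    using pos Im_cinner[of "a x" x]
    by (auto simp: positive_op_def complex_nonneg_Reals_iff inner_eq_Re_cinner)
  have "inner (a x) y = inner x (a y)" for x y
  proof -
    \<comment> \<open>Chosen so that the imaginary unit takes \<open>?z\<close> to \<open>y\<close>.
      Polarising the vanishing imaginary part at \<open>x + ?z\<close> then yields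
      self-adjointness.\<close>
    let ?z = "(- \<i>) *\<^sub>C y"
    have "\<i> *\<^sub>C ?z = y" using scaleR_scaleC[of 1 y] by (simp add: scaleC_scaleC)
    then have "inner (a x) y + inner (a ?z) (\<i> *\<^sub>C x) = 0"
      using im[of "x + ?z"] im[of x] im[of ?z]
      by (simp add: blinfun.add_right inner_add_left inner_add_right scaleC_add_right)
    moreover have "inner (a ?z) (\<i> *\<^sub>C x) = inner (a y) ((-1) *\<^sub>R x)"
      unfolding bounded_opsD[OF a] inner_scaleC_left by (simp add: scaleC_scaleC scaleR_scaleC)
    ultimately show ?thesis by (simp add: inner_commute)
  qed
  then show "pos a" using nonneg by (simp add: pos_def selfadj_def)
next
  assume "a \<in> bounded_ops \<and> pos a"
  then show "positive_op a"
    by (simp add: positive_op_def selfadj_inner_cinner pos_def complex_nonneg_Reals_iff)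
qed

lemma op_le_iff: "a \<sqsubseteq> b \<longleftrightarrow> b - a \<in> bounded_ops \<and> pos (b - a)"
  by (simp add: op_le_def positive_op_iff)

lemma op_sqrt:
  assumes "positive_op a"
  shows "pos (op_sqrt a)" "op_sqrt a o\<^sub>L op_sqrt a = a" "in_bicommutant a (op_sqrt a)"
proof -
  have a: "a \<in> bounded_ops" "pos a" using assms by (auto simp: positive_op_iff)
  obtain b where b: "pos b" "b o\<^sub>L b = a" "in_bicommutant a b" using pos_sqrt[OF a(2)] by blast
  have "op_sqrt a = b"
    unfolding op_sqrt_def
  proof (rule the_equality)
    show "positive_op b \<and> b o\<^sub>L b = a" using b bounded_ops_bicommutant[OF a(1) b(3)] by (simp add: positive_op_iff)
    show "c = b" if "positive_op c \<and> c o\<^sub>L c = a" for c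
      by (rule pos_sqrt_unique) (use that b in \<open>auto simp: positive_op_iff\<close>)
  qed
  then show "pos (op_sqrt a)" "op_sqrt a o\<^sub>L op_sqrt a = a" "in_bicommutant a (op_sqrt a)" using b by auto
qed

text \<open>The equality of norms carries estimates for \<open>op_abs a\<close> over to
  \<open>a\<close>, which takes the place of a polar decomposition.\<close>

lemma op_abs:
  assumes "a \<in> bounded_ops"
  shows "pos (op_abs a)" "in_bicommutant (adj a o\<^sub>L a) (op_abs a)" "op_abs a \<in> bounded_ops"
    "norm (op_abs a x) = norm (a x)"
proof -
  have inner_eq: "inner ((adj a o\<^sub>L a) x) y = inner (a x) (a y)" for x y
    using adj(2)[OF assms, of y "a x"] by (simp add: inner_commute)
  have bo: "adj a o\<^sub>L a \<in> bounded_ops"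
    using assms adj(1)[OF assms] by (simp add: bounded_ops_def)
  have "pos (adj a o\<^sub>L a)"
    unfolding pos_def selfadj_def
  proof (intro conjI allI)
    show "inner ((adj a o\<^sub>L a) x) y = inner x ((adj a o\<^sub>L a) y)" for x y
      using inner_eq[of x y] inner_eq[of y x] inner_commute[of x "(adj a o\<^sub>L a) y"]
        inner_commute[of "a x" "a y"] by linarith
    show "0 \<le> inner ((adj a o\<^sub>L a) x) x" for x unfolding inner_eq by (rule inner_ge_zero)
  qed
  then have "positive_op (adj a o\<^sub>L a)" using bo by (simp add: positive_op_iff)
  note r = op_sqrt[OF this, folded op_abs_def]
  show "pos (op_abs a)" "in_bicommutant (adj a o\<^sub>L a) (op_abs a)" using r by auto
  show "op_abs a \<in> bounded_ops" using bounded_ops_bicommutant[OF bo r(3)] .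
  have "(norm (op_abs a x))\<^sup>2 = (norm (a x))\<^sup>2"
    using inner_square[OF pos_selfadj[OF r(1)], of x] inner_eq[of x x]
    by (simp only: r(2) power2_norm_eq_inner[of "a x"])
  then show "norm (op_abs a x) = norm (a x)" by (simp add: power2_eq_iff_nonneg)
qed

section \<open>Scalar measures of a projection-valued measure\<close>

context
  fixes E :: "real set \<Rightarrow> 'h::chilbert_space \<Rightarrow>\<^sub>L 'h"
  assumes E: "projection_valued_measure E"
begin

lemma pvm_proj: "B \<in> sets borel \<Longrightarrow> proj (E B)"
  using E by (auto simp: projection_valued_measure_def projection_iff)

lemma pvm_UNIV: "E UNIV = id_blinfun"
  using E by (simp add: projection_valued_measure_def)

lemma pvm_Int: "A \<in> sets borel \<Longrightarrow> B \<in> sets borel \<Longrightarrow> E (A \<inter> B) x = E A (E B x)"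
  using E by (simp add: projection_valued_measure_def)

lemma pvm_sums:
  "range A \<subseteq> sets borel \<Longrightarrow> disjoint_family A \<Longrightarrow> (\<lambda>n. E (A n) x) sums E (\<Union>n::nat. A n) x"
  using E by (simp add: projection_valued_measure_def)

lemma pvm_empty: "E {} = 0"
proof (rule blinfun_eqI)
  fix x
  have "(\<lambda>n::nat. E {} x) sums E {} x"
    using pvm_sums[of "\<lambda>_. {}" x] by (simp add: disjoint_family_on_def)
  then have "(\<lambda>n::nat. E {} x) \<longlonglongrightarrow> 0" using sums_summable summable_LIMSEQ_zero by blast
  then show "E {} x = blinfun_apply 0 x" by (simp add: LIMSEQ_const_iff)
qed

lemma sets_ssm [simp, measurable_cong]: "sets (scalar_spectral_measure E x) = sets borel"
  and space_ssm [simp]: "space (scalar_spectral_measure E x) = UNIV"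
  using sets.sigma_sets_eq[of "borel :: real measure"] by (simp_all add: scalar_spectral_measure_def)

text \<open>\<open>measure_of\<close> returns the prescribed values only for a countably additive
  set function; this follows from strong convergence of the series of projections.\<close>

lemma emeasure_ssm:
  assumes "B \<in> sets borel"
  shows "emeasure (scalar_spectral_measure E x) B = ennreal (inner (E B x) x)"
proof -
  let ?m = "\<lambda>B. ennreal (inner (E B x) x)"
  have eq: "scalar_spectral_measure E x = measure_of UNIV (sets borel) ?m"
    by (simp add: scalar_spectral_measure_def inner_eq_Re_cinner)
  show ?thesis
  proof (rule emeasure_measure_of[OF eq])
    show "positive (sets (scalar_spectral_measure E x)) ?m"
      by (simp add: positive_def pvm_empty)
    show "countably_additive (sets (scalar_spectral_measure E x)) ?m"
    proof (rule countably_additiveI)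
      fix A :: "nat \<Rightarrow> real set"
      assume A: "range A \<subseteq> sets (scalar_spectral_measure E x)" "disjoint_family A"
      have "(\<lambda>n. inner (E (A n) x) x) sums inner (E (\<Union>n. A n) x) x"
        using bounded_linear.sums[OF bounded_linear_inner_left pvm_sums] A by simp
      moreover have "0 \<le> inner (E (A n) x) x" for n
        using A by (intro pos_ge_0 proj_pos pvm_proj) auto
      ultimately show "(\<Sum>n. ?m (A n)) = ?m (\<Union>n. A n)"
        by (intro suminf_ennreal_eq)
    qed
  qed (use assms in auto)
qed

lemma finite_ssm: "finite_measure (scalar_spectral_measure E x)"
  by standard (simp add: emeasure_ssm)

lemma measure_ssm: "B \<in> sets borel \<Longrightarrow> measure (scalar_spectral_measure E x) B = inner (E B x) x"
  by (simp add: measure_def emeasure_ssm pos_ge_0 proj_pos pvm_proj)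

lemma pvm_Compl: "B \<in> sets borel \<Longrightarrow> E (- B) = id_blinfun - E B"
proof (rule selfadj_eqI)
  assume B: "B \<in> sets borel"
  then have B': "- B \<in> sets borel" by auto
  show "selfadj (E (- B))" using pvm_proj[OF B'] by (rule proj_selfadj)
  show "selfadj (id_blinfun - E B)" using pvm_proj[OF B] by (simp add: proj_selfadj)
  show "inner (E (- B) x) x = inner ((id_blinfun - E B) x) x" for x
    using finite_measure.finite_measure_compl[OF finite_ssm, of B x] B B'
    by (simp add: measure_ssm Compl_eq_Diff_UNIV[symmetric] pvm_UNIV blinfun.diff_left inner_diff_left)
qed

text \<open>The measure at \<open>E B x\<close> is the one at \<open>x\<close> restricted to
  \<open>B\<close>. This expresses the form of \<open>a\<close> on the range of \<open>E B\<close>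
  as an integral over \<open>B\<close>.\<close>

lemma ssm_density:
  assumes "B \<in> sets borel"
  shows "scalar_spectral_measure E (E B x) = density (scalar_spectral_measure E x) (\<lambda>t. ennreal (indicator B t))"
proof (rule measure_eqI)
  fix A assume "A \<in> sets (scalar_spectral_measure E (E B x))"
  then have A: "A \<in> sets borel" by simp
  have "E A (E B x) = E B (E A x)" using pvm_Int[OF A assms, of x] pvm_Int[OF assms A, of x] by (simp add: Int_commute)
  then have "inner (E A (E B x)) (E B x) = inner (E (A \<inter> B) x) x"
    using selfadjD[OF proj_selfadj[OF pvm_proj[OF assms]], of "E A (E B x)" x] pvm_Int[OF A assms]
      proj_idem[OF pvm_proj[OF assms]] by metis
  moreover have "emeasure (density (scalar_spectral_measure E x) (\<lambda>t. ennreal (indicator B t))) A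
      = (\<integral>\<^sup>+t. ennreal (indicator B t) * indicator A t \<partial>scalar_spectral_measure E x)"
    using A assms by (intro emeasure_density) auto
  moreover have "\<dots> = (\<integral>\<^sup>+t. indicator (A \<inter> B) t \<partial>scalar_spectral_measure E x)"
    by (rule nn_integral_cong) (auto simp: indicator_def)
  moreover have "\<dots> = emeasure (scalar_spectral_measure E x) (A \<inter> B)"
    using A assms by (intro nn_integral_indicator) auto
  ultimately show "emeasure (scalar_spectral_measure E (E B x)) A
      = emeasure (density (scalar_spectral_measure E x) (\<lambda>t. ennreal (indicator B t))) A"
    using A assms by (simp add: emeasure_ssm)
qed simp

end

section \<open>Spectral projections of complex operators\<close>

lemma spectral_measure_exists:
  fixes a :: "'h::chilbert_space \<Rightarrow>\<^sub>L 'h"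
  assumes "a \<in> bounded_ops" "selfadj a"
  shows "\<exists>E. is_spectral_measure a E"
proof -
  interpret selfadj_op a by standard fact
  have pvm: "projection_valued_measure spec"
    unfolding projection_valued_measure_def
  proof (intro conjI ballI allI impI)
    show "projection (spec B)" if "B \<in> sets borel" for B
      using that spec(1,2) bounded_ops_bicommutant[OF assms(1)] by (simp add: projection_iff)
    show "(\<lambda>n. spec (A n) x) sums spec (\<Union> (range A)) x"
      if "range A \<subseteq> sets borel \<and> disjoint_family A" for A x
      using that by (intro spec_sums) auto
  qed (simp_all add: spec_UNIV spec_Int)
  have "scalar_spectral_measure spec x = mu x" for x
    by (rule measure_eqI) (simp_all add: pvm sets_ssm emeasure_ssm emeasure_mu)
  then have "is_spectral_measure a spec"
    using assms pvm by (simp add: is_spectral_measure_def integrable_mu selfadj_inner_cinner flip: inner_eq_integral)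
  then show ?thesis by blast
qed

text \<open>Applies to every spectral measure of \<open>a\<close>, hence to the one picked by
  \<open>SOME\<close>. The weak integral only gives diagonal values, so commutation with
  \<open>a\<close> has to be derived before \<open>splits_at_unique\<close> can identify
  \<open>1 - E {s<..}\<close> with \<open>res s\<close>.\<close>

lemma is_spectral_measure_splits_at:
  fixes a :: "'h::chilbert_space \<Rightarrow>\<^sub>L 'h"
  assumes a: "a \<in> bounded_ops" "selfadj a" and E: "is_spectral_measure a E"
  shows "splits_at a s (id_blinfun - E {s<..})" "in_bicommutant a (E {s<..})"
proof -
  let ?\<nu> = "scalar_spectral_measure E"
  define p where "p = E {s<..}"
  define q where "q = id_blinfun - p"
  have pvm: "projection_valued_measure E" using E by (simp add: is_spectral_measure_def)
  note [measurable_cong] = sets_ssm[OF pvm]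
  have intble: "integrable (?\<nu> x) (\<lambda>t. t)"
    and int: "inner (a x) x = (\<integral>t. t \<partial>?\<nu> x)" for x
    using E a by (auto simp: is_spectral_measure_def selfadj_inner_cinner)
  have p_proj: "proj p" using pvm_proj[OF pvm] by (simp add: p_def)
  have q_proj: "proj q" unfolding q_def by (rule proj_compl[OF p_proj])
  have q_eq: "q = E {..s}"
    using pvm_Compl[OF pvm, of "{s<..}"] by (simp add: p_def q_def Compl_greaterThan)
  have int_B: "inner (a (E B x)) (E B x) = (\<integral>t. indicator B t * t \<partial>?\<nu> x)" if "B \<in> sets borel" for B x
    unfolding int ssm_density[OF pvm that] using that
    by (subst integral_density) auto
  have intble_B: "integrable (?\<nu> x) (\<lambda>t. indicator B t * t)" if "B \<in> sets borel" for B x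
    using integrable_mult_indicator[OF _ intble, of B x] that by (simp add: sets_ssm[OF pvm])
  have split: "inner (a x) x = inner (a (p x)) (p x) + inner (a (q x)) (q x)" for x
  proof -
    have "inner (a (p x)) (p x) + inner (a (q x)) (q x)
        = (\<integral>t. indicator {s<..} t * t + indicator {..s} t * t \<partial>?\<nu> x)"
      unfolding q_eq p_def by (simp add: int_B intble_B)
    also have "\<dots> = (\<integral>t. t \<partial>?\<nu> x)"
      by (intro Bochner_Integration.integral_cong) (auto simp: indicator_def)
    finally show ?thesis by (simp add: int)
  qed
  \<comment> \<open>The integral splits at \<open>s\<close>, so both sides have the same quadratic
    form. Thus \<open>a\<close> is block diagonal for \<open>p\<close> and \<open>q\<close>, and it
    commutes with \<open>p\<close>.\<close>
  have "a = (p o\<^sub>L a o\<^sub>L p) + (q o\<^sub>L a o\<^sub>L q)"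
  proof (rule selfadj_eqI)
    show "selfadj ((p o\<^sub>L a o\<^sub>L p) + (q o\<^sub>L a o\<^sub>L q))"
      using a(2) p_proj q_proj by (simp add: selfadj_def proj_def blinfun.add_left inner_add_left inner_add_right)
    show "inner (a x) x = inner (((p o\<^sub>L a o\<^sub>L p) + (q o\<^sub>L a o\<^sub>L q)) x) x" for x
      using split[of x] p_proj q_proj by (simp add: blinfun.add_left inner_add_left selfadjD proj_selfadj)
  qed fact
  note eq = this
  have decomp: "a x = p (a (p x)) + q (a (q x))" for x
  proof -
    have "a x = ((p o\<^sub>L a o\<^sub>L p) + (q o\<^sub>L a o\<^sub>L q)) x"
      by (rule arg_cong[OF eq, of "\<lambda>f. blinfun_apply f x"])
    also have "\<dots> = p (a (p x)) + q (a (q x))" by (simp add: blinfun.add_left)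
    finally show ?thesis .
  qed
  have cm: "commute p a"
    unfolding commute_def
  proof
    fix x
    have "p (q y) = 0" "q (p y) = 0" for y
      by (simp_all add: q_def blinfun.diff_left blinfun.diff_right proj_idem[OF p_proj])
    then show "p (a x) = a (p x)"
      by (subst (1 2) decomp) (simp add: blinfun.add_right proj_idem[OF p_proj])
  qed
  show splits: "splits_at a s (id_blinfun - E {s<..})"
    unfolding splits_at_def q_def[unfolded p_def, symmetric]
  proof (intro conjI allI impI)
    show "proj q" by (rule q_proj)
  next
    fix x assume x: "q x = x"
    have "inner (a x) x = (\<integral>t. indicator {..s} t * t \<partial>?\<nu> x)"
      using int_B[of "{..s}" x] x by (simp add: q_eq)
    also have "\<dots> \<le> (\<integral>t. indicator {..s} t * s \<partial>?\<nu> x)"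
      by (intro integral_mono intble_B finite_measure.integrable_const_bound[OF finite_ssm[OF pvm], where B = "\<bar>s\<bar>"])
        (auto simp: indicator_def)
    also have "\<dots> = s * (norm x)\<^sup>2"
      using x by (simp add: sets_ssm[OF pvm] space_ssm[OF pvm] measure_ssm[OF pvm] q_eq power2_norm_eq_inner)
    finally show "inner (a x) x \<le> s * (norm x)\<^sup>2" .
  next
    fix x assume x: "q x = 0 \<and> x \<noteq> 0"
    then have px: "p x = x" by (simp add: q_def blinfun.diff_left)
    let ?f = "\<lambda>t. indicator {s<..} t * t - indicator {s<..} t * s"
    have int2: "integrable (?\<nu> x) (\<lambda>t. indicator {s<..} t * s)"
      by (intro finite_measure.integrable_const_bound[OF finite_ssm[OF pvm], where B = "\<bar>s\<bar>"])
        (auto simp: indicator_def)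
    have mS: "measure (?\<nu> x) {s<..} = (norm x)\<^sup>2"
      using px by (simp add: measure_ssm[OF pvm] p_def power2_norm_eq_inner)
    have f_int: "integrable (?\<nu> x) ?f" by (intro Bochner_Integration.integrable_diff intble_B int2) simp
    have "(\<integral>t. ?f t \<partial>?\<nu> x) = inner (a x) x - s * (norm x)\<^sup>2"
      using int_B[of "{s<..}" x] px mS intble_B[of "{s<..}" x] int2
      by (simp add: p_def sets_ssm[OF pvm] space_ssm[OF pvm])
    moreover have "0 \<le> (\<integral>t. ?f t \<partial>?\<nu> x)"
      by (intro integral_nonneg_AE AE_I2) (auto simp: indicator_def)
    \<comment> \<open>The integrand is strictly positive on \<open>{s<..}\<close>. A zero integral
      would make this set null, although it carries the mass
      \<open>(norm x)\<^sup>2\<close>.\<close>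
    moreover have "(\<integral>t. ?f t \<partial>?\<nu> x) \<noteq> 0"
    proof
      assume "(\<integral>t. ?f t \<partial>?\<nu> x) = 0"
      then have "AE t in ?\<nu> x. ?f t = 0"
        by (subst (asm) integral_nonneg_eq_0_iff_AE[OF f_int]) (auto simp: indicator_def)
      then have "AE t in ?\<nu> x. t \<notin> {s<..}" by (rule eventually_mono) (auto simp: indicator_def split: if_splits)
      then have "measure (?\<nu> x) {s<..} = 0"
        by (subst (asm) AE_iff_measurable[where N = "{s<..}"])
          (auto simp: sets_ssm[OF pvm] space_ssm[OF pvm] measure_def)
      then show False using x mS by simp
    qed
    ultimately show "s * (norm x)\<^sup>2 < inner (a x) x" by linarith
  qed
  \<comment> \<open>\<open>q\<close> commutes with \<open>a\<close>, hence with
    \<open>res s\<close>. Uniqueness gives \<open>q = res s\<close>, and so \<open>q\<close>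
    inherits membership in the bicommutant.\<close>
  interpret selfadj_op a by standard fact
  have "commute (res s) q"
    using in_bicommutantD[OF res(2) cm, of s] by (auto simp: q_def commute_def blinfun.diff_left blinfun.diff_right)
  then have "res s = q"
    using splits_at_unique[OF res(1) splits] by (simp add: q_def p_def)
  then have "E {s<..} = id_blinfun - res s" by (simp add: q_def p_def)
  then show "in_bicommutant a (E {s<..})" using res(2) by simp
qed

text \<open>Collects what the trace estimates need of spectral projections, with the form of
  \<open>op_abs b\<close> replaced by the norm of \<open>b x\<close>. The range bound follows by
  Cauchy-Schwarz, the kernel bound by \<open>pos_bound\<close>.\<close>

lemma spectral_projection_op_abs:
  fixes b :: "'h::chilbert_space \<Rightarrow>\<^sub>L 'h"
  assumes b: "b \<in> bounded_ops" and s: "0 \<le> s"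
  defines "p \<equiv> spectral_projection (op_abs b) {s<..}"
  shows "proj p" "in_bicommutant (adj b o\<^sub>L b) p"
    "p x = 0 \<Longrightarrow> norm (b x) \<le> s * norm x"
    "p x = x \<Longrightarrow> x \<noteq> 0 \<Longrightarrow> s * norm x < norm (b x)"
proof -
  define c where "c = op_abs b"
  have c: "pos c" "c \<in> bounded_ops" "in_bicommutant (adj b o\<^sub>L b) c" "norm (c x) = norm (b x)" for x
    using op_abs[OF b] by (auto simp: c_def)
  have "is_spectral_measure c (spectral_projection c)"
    unfolding spectral_projection_def
    by (rule someI_ex[OF spectral_measure_exists[OF c(2) pos_selfadj[OF c(1)]]])
  note r = is_spectral_measure_splits_at[OF c(2) pos_selfadj[OF c(1)] this, of s, unfolded c_def, folded p_def c_def]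
  define q where "q = id_blinfun - p"
  have q: "proj q" "\<And>x. q x = x \<Longrightarrow> inner (c x) x \<le> s * (norm x)\<^sup>2"
    "\<And>x. q x = 0 \<Longrightarrow> x \<noteq> 0 \<Longrightarrow> s * (norm x)\<^sup>2 < inner (c x) x"
    using r(1) by (auto simp: splits_at_def q_def)
  show "proj p" using proj_compl[OF q(1)] by (simp add: q_def)
  show "in_bicommutant (adj b o\<^sub>L b) p" using in_bicommutant_trans c(3) r(2) by blast
  have cq: "c (q y) = q (c y)" for y
    using in_bicommutant_self[OF r(2)] by (simp add: commute_def q_def blinfun.diff_left blinfun.diff_right)
  have inner_cq: "inner ((c o\<^sub>L q) y) y = inner (c (q y)) (q y)" for y
    using cq[of "q y"] proj_idem[OF q(1)] selfadjD[OF proj_selfadj[OF q(1)], of "c (q y)" y] by simp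
  \<comment> \<open>\<open>pos_bound\<close> needs a form bound on the whole space, so
    \<open>c\<close> is first cut down by \<open>q\<close>.\<close>
  have "pos (c o\<^sub>L q)"
    using inner_cq c(1) by (auto simp: pos_def intro!: selfadj_comp proj_selfadj[OF q(1)]) (simp add: commute_def cq)
  moreover have "inner ((c o\<^sub>L q) y) y \<le> s * (norm y)\<^sup>2" for y
  proof -
    have "inner ((c o\<^sub>L q) y) y \<le> s * (norm (q y))\<^sup>2"
      unfolding inner_cq by (rule q(2)) (rule proj_idem[OF q(1)])
    also have "\<dots> \<le> s * (norm y)\<^sup>2"
      using s proj_norm_le[OF q(1), of y] by (intro mult_left_mono power_mono) auto
    finally show ?thesis .
  qed
  ultimately have bound: "norm ((c o\<^sub>L q) y) \<le> s * norm y" for y using pos_bound s by blast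
  show "norm (b x) \<le> s * norm x" if "p x = 0"
    using bound[of x] that c(4)[of x] by (simp add: q_def blinfun.diff_left)
  show "s * norm x < norm (b x)" if "p x = x" "x \<noteq> 0"
  proof -
    have "s * (norm x)\<^sup>2 < inner (c x) x" using that by (intro q(3)) (simp_all add: q_def blinfun.diff_left)
    also have "\<dots> \<le> norm (c x) * norm x" by (rule norm_cauchy_schwarz)
    finally have "(s * norm x) * norm x < norm (b x) * norm x" by (simp add: c(4) power2_eq_square)
    then show ?thesis by (simp add: mult_less_cancel_right)
  qed
qed

section \<open>Traces and the Sugeno norm\<close>

lemma pos_add: "pos a \<Longrightarrow> pos b \<Longrightarrow> pos (a + b)"
  by (simp add: pos_def blinfun.add_left inner_add_left)

lemma in_bicommutant_sum: "(\<And>i. i \<in> I \<Longrightarrow> in_bicommutant a (f i)) \<Longrightarrow> in_bicommutant a (sum f I)"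
  by (induction I rule: infinite_finite_induct) simp_all

lemma proj_zero_sym:
  assumes "proj p" "proj q" "\<And>x. p (q x) = 0"
  shows "q (p x) = 0"
proof -
  have "inner (q (p x)) (q (p x)) = inner x (p (q (q (p x))))"
    using assms by (simp add: selfadjD proj_selfadj)
  then show ?thesis using assms(3) by simp
qed

text \<open>The bicommutant equation in terms of \<open>commute\<close>, from which closure under
  the algebraic operations and under \<open>in_bicommutant\<close> is immediate.\<close>

lemma vn_mem_iff:
  assumes "von_neumann_algebra M"
  shows "b \<in> M \<longleftrightarrow> b \<in> bounded_ops \<and> (\<forall>u\<in>commutant M. commute u b)"
proof -
  have comm: "b o\<^sub>L u = u o\<^sub>L b \<longleftrightarrow> commute u b" for u :: "'a \<Rightarrow>\<^sub>L 'a"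
  proof
    assume "b o\<^sub>L u = u o\<^sub>L b"
    then have "(b o\<^sub>L u) x = (u o\<^sub>L b) x" for x by simp
    then show "commute u b" by (simp add: commute_def)
  next
    assume "commute u b"
    then show "b o\<^sub>L u = u o\<^sub>L b" by (intro blinfun_eqI) (simp add: commute_def)
  qed
  have "b \<in> M \<longleftrightarrow> b \<in> commutant (commutant M)"
    using assms by (simp add: von_neumann_algebra_def)
  then show ?thesis by (simp add: commutant_def[of "commutant M"] comm)
qed

section \<open>Comparison of projections under a normal trace\<close>

locale vn_trace =
  fixes M :: "('h::chilbert_space \<Rightarrow>\<^sub>L 'h) set" and \<tau> :: "('h \<Rightarrow>\<^sub>L 'h) \<Rightarrow> ennreal"
  assumes vn: "von_neumann_algebra M" and trace: "is_trace M \<tau>" and normal: "normal_trace M \<tau>"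
begin

lemma M_bounded: "a \<in> M \<Longrightarrow> a \<in> bounded_ops"
  using vn by (auto simp: von_neumann_algebra_def)

lemma M_adj: "a \<in> M \<Longrightarrow> adj a \<in> M"
  using vn by (auto simp: von_neumann_algebra_def)

lemma M_id: "id_blinfun \<in> M"
  by (simp add: vn_mem_iff[OF vn] bounded_ops_iff)

lemma M_add: "a \<in> M \<Longrightarrow> b \<in> M \<Longrightarrow> a + b \<in> M" and M_diff: "a \<in> M \<Longrightarrow> b \<in> M \<Longrightarrow> a - b \<in> M"
  and M_comp: "a \<in> M \<Longrightarrow> b \<in> M \<Longrightarrow> a o\<^sub>L b \<in> M"
  by (simp_all add: vn_mem_iff[OF vn] bounded_ops_iff)

lemma M_bicommutant: "a \<in> M \<Longrightarrow> in_bicommutant a b \<Longrightarrow> b \<in> M"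
  by (simp add: vn_mem_iff[OF vn] bounded_ops_iff in_bicommutant_def)

lemma positive_part_iff: "a \<in> positive_part M \<longleftrightarrow> a \<in> M \<and> pos a"
  using M_bounded by (auto simp: positive_part_def positive_op_iff)

lemma op_le_M: "a \<in> M \<Longrightarrow> b \<in> M \<Longrightarrow> a \<sqsubseteq> b \<longleftrightarrow> pos (b - a)"
  using M_bounded[OF M_diff] by (simp add: op_le_iff)

lemma trace_add: "a \<in> M \<Longrightarrow> pos a \<Longrightarrow> b \<in> M \<Longrightarrow> pos b \<Longrightarrow> \<tau> (a + b) = \<tau> a + \<tau> b"
  using trace by (simp add: is_trace_def positive_part_iff)

lemma trace_adj: "a \<in> M \<Longrightarrow> \<tau> (adj a o\<^sub>L a) = \<tau> (a o\<^sub>L adj a)"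
  using trace by (simp add: is_trace_def)

lemma trace_mono:
  assumes "a \<in> M" "pos a" "b \<in> M" "pos (b - a)"
  shows "\<tau> a \<le> \<tau> b"
  using trace_add[of a "b - a"] M_diff[of b a] assms by simp

text \<open>Normality is stated for suprema of directed sets. The range of an increasing sequence is
  directed, and its strong limit is the least upper bound because order is tested on quadratic
  forms.\<close>

lemma trace_limit_le:
  assumes q: "\<And>n. q n \<in> M" "\<And>n. pos (q n)" and mono: "\<And>n. pos (q (Suc n) - q n)"
    and b: "b \<in> M" "pos b" and lim: "\<And>x. (\<lambda>n. q n x) \<longlonglongrightarrow> b x" and le: "\<And>n. \<tau> (q n) \<le> C"
  shows "\<tau> b \<le> C"
proof -
  have incr: "pos (q n - q m)" if "m \<le> n" for m n
    using that
  proof (induction n rule: dec_induct)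
    case base
    show ?case by (simp add: pos_def)
  next
    case (step n)
    then show ?case using pos_add[OF step.IH mono[of n]] by simp
  qed
  have inner_lim: "(\<lambda>n. inner (q n x) x) \<longlonglongrightarrow> inner (b x) x" for x
    by (intro tendsto_intros lim)
  have upper: "pos (b - q n)" for n
  proof -
    have "inner (q n x) x \<le> inner (b x) x" for x
    proof (rule LIMSEQ_le_const[OF inner_lim], intro exI allI impI)
      show "inner (q n x) x \<le> inner (q m x) x" if "n \<le> m" for m
        using pos_ge_0[OF incr[OF that], of x] by (simp add: blinfun.diff_left inner_diff_left)
    qed
    then show ?thesis using b q by (simp add: pos_def blinfun.diff_left inner_diff_left)
  qed
  have least: "pos (c - b)" if "c \<in> positive_part M" "\<And>n. pos (c - q n)" for c
  proof -
    have "inner (b x) x \<le> inner (c x) x" for x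
    proof (rule LIMSEQ_le_const2[OF inner_lim], intro exI allI impI)
      show "inner (q m x) x \<le> inner (c x) x" for m
        using pos_ge_0[OF that(2), of m x] by (simp add: blinfun.diff_left inner_diff_left)
    qed
    then show ?thesis using b that(1) by (simp add: positive_part_iff pos_def blinfun.diff_left inner_diff_left)
  qed
  have "\<tau> b = (SUP x\<in>range q. \<tau> x)"
  proof (rule normal[unfolded normal_trace_def, rule_format], intro conjI ballI allI impI)
    show "range q \<subseteq> positive_part M" using q by (auto simp: positive_part_iff)
    show "range q \<noteq> {}" by simp
    show "b \<in> positive_part M" using b by (simp add: positive_part_iff)
    show "x \<sqsubseteq> b" if "x \<in> range q" for x using that q b upper by (auto simp: op_le_M)
    show "b \<sqsubseteq> c" if "c \<in> positive_part M" "\<forall>x\<in>range q. x \<sqsubseteq> c" for c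
      using that q b least[of c] by (simp add: op_le_M positive_part_iff)
    show "\<exists>z\<in>range q. x \<sqsubseteq> z \<and> y \<sqsubseteq> z" if xy: "x \<in> range q" "y \<in> range q" for x y
    proof -
      obtain m n where "x = q m" "y = q n" using xy by auto
      then have "x \<sqsubseteq> q (max m n)" "y \<sqsubseteq> q (max m n)" using q incr by (simp_all add: op_le_M)
      then show ?thesis by blast
    qed
  qed
  also have "\<dots> \<le> C" using le by (auto intro: SUP_least)
  finally show ?thesis .
qed

text \<open>With \<open>h = r p r\<close>, the operators \<open>1 - (1 - h)\<^sup>n = h (\<Sum>k<n. (1 - h)\<^sup>k)\<close> increase to the
  support projection of \<open>h\<close>, which dominates \<open>r\<close>. Each of them is \<open>y\<^sup>* y\<close> with
  \<open>y = p r (\<Sum>k<n. (1 - h)\<^sup>k)\<^sup>1\<^sup>/\<^sup>2\<close>, and \<open>y y\<^sup>* \<le> p\<close>; this replaces the polar decomposition.\<close>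

lemma trace_le_of_injective:
  assumes r: "r \<in> M" "proj r" and p: "p \<in> M" "proj p"
    and inj: "\<And>x. r x = x \<Longrightarrow> p x = 0 \<Longrightarrow> x = 0"
  shows "\<tau> r \<le> \<tau> p"
proof -
  have r_sym: "inner (r x) y = inner x (r y)" and p_sym: "inner (p x) y = inner x (p y)" for x y
    using r(2) p(2) by (auto simp: proj_selfadj selfadjD)
  have rr: "r (r x) = r x" and pp: "p (p x) = p x" for x using r(2) p(2) by (auto simp: proj_idem)
  define h where "h = r o\<^sub>L p o\<^sub>L r"
  have hM: "h \<in> M" unfolding h_def using r p by (intro M_comp)
  have h_inner: "inner (h x) x = (norm (p (r x)))\<^sup>2" for x
    by (simp add: h_def r_sym proj_inner[OF p(2)])
  have h_sa: "selfadj h" by (simp add: h_def selfadj_def r_sym p_sym)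
  define c where "c = id_blinfun - h"
  have cM: "c \<in> M" unfolding c_def using hM by (intro M_diff M_id)
  have c_inner: "inner (c x) x = (norm x)\<^sup>2 - (norm (p (r x)))\<^sup>2" for x
    by (simp add: c_def blinfun.diff_left inner_diff_left h_inner power2_norm_eq_inner[of x])
  have "norm (p (r x)) \<le> norm x" for x
    using proj_norm_le[OF p(2)] proj_norm_le[OF r(2)] order_trans by blast
  then have c: "pos c" by (simp add: pos_def c_inner power_mono) (simp add: c_def h_sa)
  have c_le: "inner (c x) x \<le> (norm x)\<^sup>2" for x by (simp add: c_inner)
  obtain N where N: "proj N" "in_bicommutant c N" "\<And>x. (\<lambda>n. opow c n x) \<longlonglongrightarrow> N x"
      "\<And>x. c (N x) = N x"
    by (rule opow_strong_limit[OF c c_le], rule that)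
  define b where "b = id_blinfun - N"
  have bM: "b \<in> M" unfolding b_def using M_bicommutant[OF cM N(2)] by (intro M_diff M_id)
  have b_proj: "proj b" unfolding b_def by (rule proj_compl[OF N(1)])
  \<comment> \<open>A fixed vector of \<open>c\<close> is killed by \<open>h\<close>, so
    \<open>p (r (N x)) = 0\<close>, and injectivity of \<open>p\<close> on the range of
    \<open>r\<close> applies. Hence \<open>b = 1 - N\<close> dominates \<open>r\<close>.\<close>
  have rN: "r (N x) = 0" for x
  proof -
    have "h (N x) = 0" using N(4)[of x] by (simp add: c_def blinfun.diff_left)
    then have "p (r (N x)) = 0" using h_inner[of "N x"] by simp
    then show ?thesis using inj rr by blast
  qed
  have "proj (b - r)"
    by (rule proj_diff[OF r(2) b_proj])
      (simp_all add: b_def blinfun.diff_left blinfun.diff_right rN proj_zero_sym[OF r(2) N(1) rN])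
  then have "\<tau> r \<le> \<tau> b" using r bM by (intro trace_mono proj_pos)
  also have "\<tau> b \<le> \<tau> p"
  proof (rule trace_limit_le[where q = "\<lambda>n. id_blinfun - opow c n"])
    show qM: "id_blinfun - opow c n \<in> M" for n
      using M_bicommutant[OF cM in_bicommutant_opow] by (intro M_diff M_id)
    have sa: "selfadj (opow c n)" for n using c by (simp add: selfadj_opow pos_selfadj)
    have q_le: "inner (opow c n x) x \<le> (norm x)\<^sup>2" for n x
    proof (induction n)
      case (Suc n)
      then show ?case using pos_opow(2)[OF c c_le, of n x] by linarith
    qed (simp add: power2_norm_eq_inner)
    show q_pos: "pos (id_blinfun - opow c n)" for n
      using q_le by (simp add: pos_def sa blinfun.diff_left inner_diff_left power2_norm_eq_inner)
    show "pos (id_blinfun - opow c (Suc n) - (id_blinfun - opow c n))" for n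
      using pos_opow(2)[OF c c_le, of n] sa[of n] sa[of "Suc n"]
      by (simp add: pos_def blinfun.diff_left inner_diff_left del: opow.simps)
    show "b \<in> M" "pos b" using bM b_proj by (auto intro: proj_pos)
    show "(\<lambda>n. (id_blinfun - opow c n) x) \<longlonglongrightarrow> b x" for x
      unfolding b_def blinfun.diff_left by (intro tendsto_intros N(3))
    show "\<tau> (id_blinfun - opow c n) \<le> \<tau> p" for n
    proof -
      define Q where "Q = (\<Sum>k<n. opow c k)"
      have Q_bic: "in_bicommutant c Q" unfolding Q_def by (intro in_bicommutant_sum in_bicommutant_opow)
      \<comment> \<open>Telescoping geometric sum, with \<open>h = 1 - c\<close>.\<close>
      have hQ: "h (Q x) = x - opow c n x" for x
        unfolding Q_def by (induction n) (simp_all add: blinfun.add_left blinfun.add_right c_def blinfun.diff_left)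
      have "pos Q" unfolding Q_def
      proof (induction n)
        case (Suc n)
        then show ?case using pos_add[OF Suc pos_opow(1)[OF c c_le, of n]] by simp
      qed (simp add: pos_def)
      then obtain g where g: "pos g" "g o\<^sub>L g = Q" "in_bicommutant Q g" using pos_sqrt by blast
      have g_bic: "in_bicommutant c g" using in_bicommutant_trans[OF Q_bic g(3)] .
      have gM: "g \<in> M" using M_bicommutant[OF cM g_bic] .
      have gh: "h (g x) = g (h x)" for x
        using in_bicommutant_self[OF g_bic] by (simp add: commute_def c_def blinfun.diff_left blinfun.diff_right)
      have g_sym: "inner (g x) y = inner x (g y)" for x y using g(1) by (simp add: pos_selfadj selfadjD)
      define y where "y = p o\<^sub>L r o\<^sub>L g"
      define y' where "y' = g o\<^sub>L r o\<^sub>L p"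
      have yM: "y \<in> M" unfolding y_def using p r gM by (intro M_comp)
      have sym: "inner (y x) z = inner x (y' z)" for x z
        by (simp add: y_def y'_def p_sym r_sym g_sym)
      have adj_y: "adj y = y'" by (rule adj_eqI(1)[OF M_bounded[OF yM] sym])
      have y'y: "y' o\<^sub>L y = id_blinfun - opow c n"
      proof (rule blinfun_eqI)
        fix x
        have "(y' o\<^sub>L y) x = g (h (g x))" by (simp add: y_def y'_def h_def pp)
        also have "\<dots> = h (Q x)" by (simp add: gh flip: g(2))
        finally show "(y' o\<^sub>L y) x = (id_blinfun - opow c n) x" by (simp add: hQ blinfun.diff_left)
      qed
      have y_contr: "norm (y z) \<le> norm z" for z
      proof -
        have "(norm (y z))\<^sup>2 = inner ((y' o\<^sub>L y) z) z"
          by (simp add: power2_norm_eq_inner sym inner_commute)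
        also have "\<dots> \<le> (norm z)\<^sup>2"
          unfolding y'y using pos_ge_0[OF pos_opow(1)[OF c c_le], of n z]
          by (simp add: blinfun.diff_left inner_diff_left power2_norm_eq_inner)
        finally show ?thesis by (rule power2_le_imp_le) simp
      qed
      have yy'_inner: "inner ((y o\<^sub>L y') x) x = (norm (y' x))\<^sup>2" for x
        by (simp add: sym power2_norm_eq_inner)
      \<comment> \<open>\<open>y\<close> takes values in the range of \<open>p\<close>, so
        \<open>(norm (y' x))\<^sup>2 = inner (y (y' x)) (p x)\<close>; since \<open>y\<close> is a
        contraction, one factor \<open>norm (y' x)\<close> cancels. This is the bound of
        \<open>y y'\<close> by \<open>p\<close>.\<close>
      have y'_le: "norm (y' x) \<le> norm (p x)" for x
      proof -
        have "(norm (y' x))\<^sup>2 = inner (y (y' x)) (p x)"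
          using yy'_inner[of x] by (simp add: y_def pp flip: p_sym)
        also have "\<dots> \<le> norm (y (y' x)) * norm (p x)" by (rule norm_cauchy_schwarz)
        also have "\<dots> \<le> norm (y' x) * norm (p x)" by (intro mult_right_mono y_contr) simp
        finally show ?thesis
          by (cases "norm (y' x) = 0") (auto simp: power2_eq_square)
      qed
      have "\<tau> (id_blinfun - opow c n) = \<tau> (y o\<^sub>L y')"
        using trace_adj[OF yM] by (simp add: adj_y y'y)
      also have "\<dots> \<le> \<tau> p"
      proof (rule trace_mono)
        show "y o\<^sub>L y' \<in> M" using yM M_adj[OF yM] by (intro M_comp) (simp_all add: adj_y)
        have sa': "selfadj (y o\<^sub>L y')"
          by (simp add: selfadj_def sym) (metis inner_commute sym)
        then show "pos (y o\<^sub>L y')" by (simp only: pos_def yy'_inner) simp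
        have "(norm (y' x))\<^sup>2 \<le> inner (p x) x" for x
          using y'_le[of x] by (simp add: proj_inner[OF p(2)] power_mono)
        then show "pos (p - (y o\<^sub>L y'))"
          using sa' p(2) by (simp only: pos_def blinfun.diff_left inner_diff_left yy'_inner) (simp add: proj_selfadj)
      qed (rule p)
      finally show ?thesis .
    qed
  qed
  finally show ?thesis .
qed

text \<open>\<open>N\<close> projects onto the common kernel of \<open>p\<close> and
  \<open>q\<close>, so \<open>e = 1 - N\<close> is their join. \<open>e\<close> is injective on the
  range of \<open>r\<close>, and \<open>q\<close> is injective on the range of \<open>e - p\<close>;
  two uses of \<open>trace_le_of_injective\<close> give the bounds for \<open>r\<close> and for
  \<open>e - p\<close>.\<close>

lemma trace_le_add:
  assumes p: "p \<in> M" "proj p" and q: "q \<in> M" "proj q" and r: "r \<in> M" "proj r"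
    and inj: "\<And>x. r x = x \<Longrightarrow> p x = 0 \<Longrightarrow> q x = 0 \<Longrightarrow> x = 0"
  shows "\<tau> r \<le> \<tau> p + \<tau> q"
proof -
  have "selfadj (p + q)" using p q by (simp add: proj_selfadj)
  then obtain N where N: "proj N" "in_bicommutant (p + q) N" "\<And>x. (p + q) (N x) = 0"
      "\<And>x. (p + q) x = 0 \<Longrightarrow> N x = x"
    using kernel_projection by blast
  define e where "e = id_blinfun - N"
  have eM: "e \<in> M" unfolding e_def using M_bicommutant[OF M_add[OF p(1) q(1)] N(2)] by (intro M_diff M_id)
  have e_proj: "proj e" unfolding e_def by (rule proj_compl[OF N(1)])
  have ker: "p (N x) = 0 \<and> q (N x) = 0" for x
  proof -
    have "inner (p (N x)) (N x) + inner (q (N x)) (N x) = 0"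
      using N(3)[of x] by (metis blinfun.add_left inner_add_left inner_zero_left)
    then show ?thesis unfolding proj_inner[OF p(2)] proj_inner[OF q(2)] by (simp add: sum_power2_eq_zero_iff)
  qed
  have fixed: "N x = x" if "p x = 0" "q x = 0" for x
    using that by (intro N(4)) (simp add: blinfun.add_left)
  have pN: "p (N x) = 0" for x using ker by blast
  have diff_proj: "proj (e - p)"
    by (rule proj_diff[OF p(2) e_proj])
      (simp_all add: e_def blinfun.diff_left blinfun.diff_right pN proj_zero_sym[OF p(2) N(1) pN])
  have "\<tau> r \<le> \<tau> e"
  proof (rule trace_le_of_injective[OF r eM e_proj])
    fix x assume x: "r x = x" "e x = 0"
    then have "N x = x" by (simp add: e_def blinfun.diff_left)
    then show "x = 0" using inj[OF x(1)] ker[of x] by simp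
  qed
  also have "\<tau> e = \<tau> p + \<tau> (e - p)"
    using trace_add[OF p(1) proj_pos[OF p(2)] M_diff[OF eM p(1)] proj_pos[OF diff_proj]] by simp
  also have "\<tau> (e - p) \<le> \<tau> q"
  proof (rule trace_le_of_injective[OF M_diff[OF eM p(1)] diff_proj q])
    fix x assume x: "(e - p) x = x" "q x = 0"
    have "p ((e - p) x) = 0"
      by (simp add: e_def blinfun.diff_left blinfun.diff_right pN proj_idem[OF p(2)])
    then have "p x = 0" by (simp add: x)
    then have "N x = x" using fixed x by blast
    then show "x = 0" using x \<open>p x = 0\<close> by (simp add: e_def blinfun.diff_left)
  qed
  finally show ?thesis by (simp add: add_left_mono)
qed

lemma trace_spectral_projection_add:
  assumes b: "b \<in> M" and c: "c \<in> M" and s: "0 \<le> s" and t: "0 \<le> t"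
  shows "\<tau> (spectral_projection (op_abs (b + c)) {s + t<..})
    \<le> \<tau> (spectral_projection (op_abs b) {s<..}) + \<tau> (spectral_projection (op_abs c) {t<..})"
proof -
  have M: "spectral_projection (op_abs a) {u<..} \<in> M" if "a \<in> M" "0 \<le> u" for a u
    using spectral_projection_op_abs(2)[OF M_bounded[OF that(1)] that(2)]
    by (rule M_bicommutant[rotated]) (intro M_comp M_adj that)
  have st: "0 \<le> s + t" using s t by simp
  note P = spectral_projection_op_abs[OF M_bounded]
  show ?thesis
  proof (rule trace_le_add)
    fix x
    assume x: "spectral_projection (op_abs (b + c)) {s + t<..} x = x"
      "spectral_projection (op_abs b) {s<..} x = 0" "spectral_projection (op_abs c) {t<..} x = 0"
    have "norm ((b + c) x) \<le> norm (b x) + norm (c x)" by (simp add: blinfun.add_left norm_triangle_ineq)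
    also have "\<dots> \<le> s * norm x + t * norm x" using P(3)[OF b s x(2)] P(3)[OF c t x(3)] by simp
    finally have "norm ((b + c) x) \<le> (s + t) * norm x" by (simp add: distrib_right)
    then show "x = 0" using P(4)[OF M_add[OF b c] st x(1)] by force
  qed (use M[OF b s] M[OF c t] M[OF M_add[OF b c] st] P(1)[OF b s] P(1)[OF c t] P(1)[OF M_add[OF b c] st] in auto)
qed

text \<open>Keeps all arguments of \<open>\<alpha>\<close> within its domain in the finite
  case.\<close>

lemma trace_spectral_projection_le:
  assumes "b \<in> M" "0 \<le> s"
  shows "\<tau> (spectral_projection (op_abs b) {s<..}) \<le> \<tau> id_blinfun"
proof (rule trace_mono)
  note P = spectral_projection_op_abs[OF M_bounded[OF assms(1)] assms(2)]
  show "spectral_projection (op_abs b) {s<..} \<in> M"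
    using P(2) by (rule M_bicommutant[rotated]) (intro M_comp M_adj assms)
  show "pos (spectral_projection (op_abs b) {s<..})" "pos (id_blinfun - spectral_projection (op_abs b) {s<..})"
    using P(1) by (auto intro: proj_pos proj_compl)
qed (rule M_id)

text \<open>Subadditivity is assumed only for values up to the trace of the identity, so the
  statement covers \<open>\<alpha>\<close> on the half-line as well as on the unit interval.\<close>

lemma sugeno_norm_triangle:
  assumes subadd: "\<And>x y z. x \<le> y + z \<Longrightarrow> x \<le> \<tau> id_blinfun \<Longrightarrow> y \<le> \<tau> id_blinfun \<Longrightarrow> z \<le> \<tau> id_blinfun \<Longrightarrow>
      extend_infinity \<alpha> x \<le> extend_infinity \<alpha> y + extend_infinity \<alpha> z"
    and b: "b \<in> M" and c: "c \<in> M"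
  shows "sugeno_norm \<tau> \<alpha> (b + c) \<le> sugeno_norm \<tau> \<alpha> b + sugeno_norm \<tau> \<alpha> c"
proof (cases "sugeno_norm \<tau> \<alpha> b = \<infinity> \<or> sugeno_norm \<tau> \<alpha> c = \<infinity>")
  case True
  then show ?thesis by auto
next
  case False
  define d where "d a s = extend_infinity \<alpha> (\<tau> (spectral_projection (op_abs a) {s<..}))" for a s
  have norm_eq: "sugeno_norm \<tau> \<alpha> a = (SUP s\<in>{0..}. min (ennreal s) (d a s))" for a
    by (simp add: sugeno_norm_def sugeno_trace_def d_def)
  obtain S T where S: "sugeno_norm \<tau> \<alpha> b = ennreal S" "0 \<le> S" and T: "sugeno_norm \<tau> \<alpha> c = ennreal T" "0 \<le> T"
    using False by (cases "sugeno_norm \<tau> \<alpha> b"; cases "sugeno_norm \<tau> \<alpha> c") auto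
  \<comment> \<open>For \<open>s > S'\<close> the minimum can stay below \<open>S'\<close> only
    through its second argument.\<close>
  have d_le: "d a s \<le> ennreal S'" if "sugeno_norm \<tau> \<alpha> a = ennreal S'" "0 \<le> S'" "S' < s" for a s S'
  proof -
    have "min (ennreal s) (d a s) \<le> ennreal S'"
      unfolding that(1)[symmetric] norm_eq using that by (intro SUP_upper) auto
    moreover have "ennreal S' < ennreal s" using that by (simp add: ennreal_less_iff)
    ultimately show ?thesis by (auto simp: min_le_iff_disj)
  qed
  have "min (ennreal r) (d (b + c) r) \<le> ennreal (S + T)" if "0 \<le> r" for r
  proof (cases "r \<le> S + T")
    case True
    then show ?thesis by (simp add: min.coboundedI1 ennreal_leI)
  next
    case False
    \<comment> \<open>Splits the excess of \<open>r\<close> over \<open>S + T\<close> evenly, so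
      that both levels strictly exceed the respective norms, as \<open>d_le\<close>
      requires.\<close>
    define \<delta> where "\<delta> = (r - S - T) / 2"
    have \<delta>: "S < S + \<delta>" "T < T + \<delta>" "0 \<le> S + \<delta>" "0 \<le> T + \<delta>" "(S + \<delta>) + (T + \<delta>) = r"
      using False S T by (auto simp: \<delta>_def field_simps)
    have "d (b + c) r \<le> d b (S + \<delta>) + d c (T + \<delta>)"
      unfolding d_def
      by (intro subadd trace_spectral_projection_le b c \<delta> M_add that
          trace_spectral_projection_add[OF b c \<delta>(3,4), unfolded \<delta>(5)])
    also have "\<dots> \<le> ennreal S + ennreal T"
      by (intro add_mono d_le S T \<delta>)
    finally show ?thesis using S T by (simp add: min.coboundedI2)
  qed
  then show ?thesis unfolding S(1) T(1) norm_eq[of "b + c"] using S T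
    by (intro SUP_least) (simp flip: ennreal_plus)
qed

end

section \<open>Subadditivity of concave functions and the value at infinity\<close>

text \<open>For \<open>x > y\<close>, concavity between 0 and \<open>x\<close> gives
  \<open>(u / x) * \<alpha> x \<le> \<alpha> u\<close>. Add the cases \<open>u = y\<close> and
  \<open>u = x - y\<close>, and use \<open>x - y \<le> z\<close>. The form
  \<open>x \<le> y + z\<close> allows \<open>y + z\<close> to lie outside \<open>I\<close>, as
  happens on the unit interval.\<close>

lemma concave_subadditive:
  fixes \<alpha> :: "real \<Rightarrow> real"
  assumes conc: "concave_on I \<alpha>" and mono: "mono_on I \<alpha>" and zero: "\<alpha> 0 = 0"
    and I: "\<And>x. x \<in> I \<Longrightarrow> {0..x} \<subseteq> I" and nonneg: "\<And>x. x \<in> I \<Longrightarrow> 0 \<le> \<alpha> x"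
    and xyz: "x \<in> I" "y \<in> I" "z \<in> I" "0 \<le> x" "0 \<le> y" "0 \<le> z" "x \<le> y + z"
  shows "\<alpha> x \<le> \<alpha> y + \<alpha> z"
proof (cases "x \<le> y")
  case True
  then show ?thesis using mono_onD[OF mono xyz(1,2)] nonneg[OF xyz(3)] by simp
next
  case False
  then have "x > 0" using xyz by simp
  have star: "(u / x) * \<alpha> x \<le> \<alpha> u" if "0 \<le> u" "u \<le> x" for u
  proof -
    have "(1 - u / x) * \<alpha> 0 + (u / x) * \<alpha> x \<le> \<alpha> ((1 - u / x) *\<^sub>R 0 + (u / x) *\<^sub>R x)"
      using that \<open>x > 0\<close> I[OF xyz(1)] by (intro concave_onD[OF conc]) (auto simp: xyz)
    then show ?thesis using \<open>x > 0\<close> by (simp add: zero)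
  qed
  have "\<alpha> x = (y / x) * \<alpha> x + ((x - y) / x) * \<alpha> x"
    using \<open>x > 0\<close> by (simp add: field_simps)
  also have "\<dots> \<le> \<alpha> y + \<alpha> (x - y)" using False xyz by (intro add_mono star) auto
  also have "\<alpha> (x - y) \<le> \<alpha> z"
    using False xyz I[OF xyz(1)] by (intro mono_onD[OF mono]) auto
  finally show ?thesis by simp
qed

lemma extend_infinity_ennreal: "0 \<le> r \<Longrightarrow> extend_infinity \<alpha> (ennreal r) = ennreal (\<alpha> r)"
  by (simp add: extend_infinity_def)

text \<open>\<open>Lim\<close> is meaningful only for a convergent function; by monotonicity the
  limit exists in \<open>ennreal\<close> and is the supremum.\<close>

lemma extend_infinity_le_top:
  assumes mono: "mono_on {0..} \<alpha>" and "0 \<le> r"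
  shows "ennreal (\<alpha> r) \<le> extend_infinity \<alpha> \<infinity>"
proof -
  let ?S = "SUP r\<in>{0..}. ennreal (\<alpha> r)"
  have "((\<lambda>r. ennreal (\<alpha> r)) \<longlongrightarrow> ?S) at_top"
  proof (rule order_tendstoI)
    fix u assume "u < ?S"
    then obtain r0 where r0: "0 \<le> r0" "u < ennreal (\<alpha> r0)" by (auto simp: less_SUP_iff)
    show "\<forall>\<^sub>F r in at_top. u < ennreal (\<alpha> r)"
      using eventually_ge_at_top[of r0]
    proof eventually_elim
      case (elim r)
      then have "\<alpha> r0 \<le> \<alpha> r" using r0 by (intro mono_onD[OF mono]) auto
      then show ?case using r0(2) by (meson ennreal_leI less_le_trans)
    qed
  next
    fix u assume u: "?S < u"
    show "\<forall>\<^sub>F r in at_top. ennreal (\<alpha> r) < u"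
      using eventually_ge_at_top[of 0]
    proof eventually_elim
      case (elim r)
      then have "ennreal (\<alpha> r) \<le> ?S" by (intro SUP_upper) simp
      then show ?case using u by (rule le_less_trans)
    qed
  qed
  then have "extend_infinity \<alpha> \<infinity> = ?S"
    by (simp add: extend_infinity_def tendsto_Lim)
  then show ?thesis using assms(2) by (auto intro: SUP_upper)
qed

theorem theorem4p4:
  fixes M :: "('h::chilbert_space \<Rightarrow>\<^sub>L 'h) set"
    and \<tau> :: "('h \<Rightarrow>\<^sub>L 'h) \<Rightarrow> ennreal"
    and \<alpha> :: "real \<Rightarrow> real"
  shows "(type_II_infinity_factor M \<and>
          is_trace M \<tau> \<and> faithful_trace M \<tau> \<and> normal_trace M \<tau> \<and> semifinite_trace M \<tau> \<and>
          \<alpha> ` {0..} \<subseteq> {0..} \<and> mono_on {0..} \<alpha> \<and> continuous_on {0..} \<alpha> \<and>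
          \<alpha> 0 = 0 \<and> (\<forall>t>0. \<alpha> t > 0) \<and> concave_on {0..} \<alpha>
          \<longrightarrow> (\<forall>b\<in>M. \<forall>c\<in>M. sugeno_norm \<tau> \<alpha> (b + c) \<le> sugeno_norm \<tau> \<alpha> b + sugeno_norm \<tau> \<alpha> c))
       \<and> (type_II_1_factor M \<and>
          is_trace M \<tau> \<and> faithful_trace M \<tau> \<and> normal_trace M \<tau> \<and> finite_trace M \<tau> \<and>
          \<tau> id_blinfun = 1 \<and>
          \<alpha> ` {0..1} \<subseteq> {0..} \<and> mono_on {0..1} \<alpha> \<and> continuous_on {0..1} \<alpha> \<and>
          \<alpha> 0 = 0 \<and> (\<forall>t\<in>{0<..1}. \<alpha> t > 0) \<and> concave_on {0..1} \<alpha>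
          \<longrightarrow> (\<forall>b\<in>M. \<forall>c\<in>M. sugeno_norm \<tau> \<alpha> (b + c) \<le> sugeno_norm \<tau> \<alpha> b + sugeno_norm \<tau> \<alpha> c))"
proof (intro conjI impI ballI; elim conjE)
  fix b c assume bc: "b \<in> M" "c \<in> M"
  assume M: "type_II_infinity_factor M" and \<tau>: "is_trace M \<tau>" "normal_trace M \<tau>"
    and nonneg: "\<alpha> ` {0..} \<subseteq> {0..}" and mono: "mono_on {0..} \<alpha>" and zero: "\<alpha> 0 = 0"
    and conc: "concave_on {0..} \<alpha>"
  interpret vn_trace M \<tau>
    using M \<tau> by unfold_locales (auto simp: type_II_infinity_factor_def type_II_factor_def factor_def)
  show "sugeno_norm \<tau> \<alpha> (b + c) \<le> sugeno_norm \<tau> \<alpha> b + sugeno_norm \<tau> \<alpha> c"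
  proof (rule sugeno_norm_triangle[OF _ bc])
    fix x y z :: ennreal assume le: "x \<le> y + z"
    \<comment> \<open>Settles the case of an infinite \<open>y\<close> or \<open>z\<close>, where
      the right-hand side is at least the value of \<open>\<alpha>\<close> at infinity.\<close>
    have mono_top: "extend_infinity \<alpha> x \<le> extend_infinity \<alpha> \<infinity>"
      by (cases x) (use extend_infinity_le_top[OF mono] in \<open>simp_all add: extend_infinity_ennreal\<close>)
    show "extend_infinity \<alpha> x \<le> extend_infinity \<alpha> y + extend_infinity \<alpha> z"
    proof (cases "y = \<infinity> \<or> z = \<infinity>")
      case True
      then show ?thesis using mono_top by (auto intro: order_trans simp: add_increasing add_increasing2)
    next
      case False
      then obtain y' z' where yz: "y = ennreal y'" "0 \<le> y'" "z = ennreal z'" "0 \<le> z'"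
        by (cases y; cases z) auto
      then have "x < \<infinity>" using le by (auto simp: less_top[symmetric] top_unique)
      then obtain x' where x: "x = ennreal x'" "0 \<le> x'" by (cases x) auto
      have "\<alpha> x' \<le> \<alpha> y' + \<alpha> z'"
        by (rule concave_subadditive[OF conc mono zero])
          (use nonneg x yz le in \<open>auto simp flip: ennreal_plus\<close>)
      moreover have "0 \<le> \<alpha> y'" "0 \<le> \<alpha> z'" using nonneg yz by auto
      ultimately show ?thesis
        by (simp add: x yz extend_infinity_ennreal ennreal_leI flip: ennreal_plus)
    qed
  qed
next
  fix b c assume bc: "b \<in> M" "c \<in> M"
  assume M: "type_II_1_factor M" and \<tau>: "is_trace M \<tau>" "normal_trace M \<tau>" and \<tau>_1: "\<tau> id_blinfun = 1"
    and nonneg: "\<alpha> ` {0..1} \<subseteq> {0..}" and mono: "mono_on {0..1} \<alpha>" and zero: "\<alpha> 0 = 0"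
    and conc: "concave_on {0..1} \<alpha>"
  interpret vn_trace M \<tau>
    using M \<tau> by unfold_locales (auto simp: type_II_1_factor_def type_II_factor_def factor_def)
  show "sugeno_norm \<tau> \<alpha> (b + c) \<le> sugeno_norm \<tau> \<alpha> b + sugeno_norm \<tau> \<alpha> c"
  proof (rule sugeno_norm_triangle[OF _ bc], unfold \<tau>_1)
    \<comment> \<open>The normalisation of the trace makes all three values real numbers in the unit
      interval, so the value at infinity never occurs.\<close>
    have real: "\<exists>r. u = ennreal r \<and> 0 \<le> r \<and> r \<le> 1" if "u \<le> 1" for u :: ennreal
      using that by (cases u) (auto simp: top_unique)
    fix x y z :: ennreal assume le: "x \<le> y + z" and "x \<le> 1" "y \<le> 1" "z \<le> 1"
    then obtain x' y' z' where xyz: "x = ennreal x'" "0 \<le> x'" "x' \<le> 1"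
      "y = ennreal y'" "0 \<le> y'" "y' \<le> 1" "z = ennreal z'" "0 \<le> z'" "z' \<le> 1"
      using real by metis
    have nonneg': "0 \<le> \<alpha> u" if "u \<in> {0..1}" for u
      using nonneg that by (simp add: image_subset_iff)
    have "\<alpha> x' \<le> \<alpha> y' + \<alpha> z'"
      by (rule concave_subadditive[OF conc mono zero])
        (use nonneg' xyz le in \<open>auto simp flip: ennreal_plus\<close>)
    moreover have "0 \<le> \<alpha> y'" "0 \<le> \<alpha> z'" using nonneg' xyz by auto
    ultimately show "extend_infinity \<alpha> x \<le> extend_infinity \<alpha> y + extend_infinity \<alpha> z"
      by (simp add: xyz extend_infinity_ennreal ennreal_leI flip: ennreal_plus)
  qed
qed

end
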